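(* Let $\mathbb{K}$ be a field of characteristic zero. Let $D$ be a nonzero triangular derivation of $\mathbb{K}[x_1,\dots,x_n]$ and let $F\in\ker D$. Then $\exp(FD)$ is normally co-tame.
   Context: A triangular derivation is a $\mathbb{K}$-derivation $D$ of $\mathbb{K}[x_1,\dots,x_n]$ with $D(x_i)\in\mathbb{K}[x_1,\dots,x_{i-1}]$ for every $i$ (so $D(x_1)\in\mathbb{K}$). For $F\in\ker D$, the derivation $FD$ is locally nilpotent, and $\exp(FD)$ is the polynomial automorphism of $\mathbb{A}^n$ corresponding to the ring automorphism $P\mapsto\sum_{k\ge0}\frac{1}{k!}(FD)^k(P)$; it has Jacobian determinant $1$. $\mathrm{GA}_n(\mathbb{K})$ is the group of polynomial automorphisms of $\mathbb{A}^n$ over $\mathbb{K}$ and $\mathrm{SA}_n(\mathbb{K})$ is the subgroup of automorphisms with Jacobian determinant $1$. For $H\subseteq\mathrm{SA}_n(\mathbb{K})$, $\langle H\rangle^S$ is the normal subgroup of $\mathrm{SA}_n(\mathbb{K})$ generated by $H$. $\mathrm{SLIN}_n(\mathbb{K})=\langle \mathrm{SL}_n(\mathbb{K})\rangle^S$, where $\mathrm{SL}_n(\mathbb{K})$ is viewed as the group of linear automorphisms of determinant $1$. An element $\theta\in\mathrm{SA}_n(\mathbb{K})$ is normally co-tame if $\langle\theta\rangle^S\supseteq\mathrm{SLIN}_n(\mathbb{K})$.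
   Formalization: The hypothesis that F is nonzero is added: for F = 0 the automorphism exp(FD) is the identity, whose normal closure is trivial, so the claim fails for n ≥ 2. *)

theory Defs
  imports
    "HOL-Library.Poly_Mapping"
    "HOL-Algebra.Coset"
    "HOL-Analysis.Determinants"
begin

text \<open>
  The polynomial ring in \<open>n = CARD('n)\<close> variables over \<open>'k\<close> is \<open>('n, 'k) mpol\<close>. The finite linear
  order \<open>'n\<close> plays the role of \<open>1 < \<dots> < n\<close>; the order matters only for triangularity.
\<close>

type_synonym ('n, 'k) mpol = "('n \<Rightarrow>\<^sub>0 nat) \<Rightarrow>\<^sub>0 'k"

definition Cst :: "'k::zero \<Rightarrow> ('n, 'k) mpol"
  where "Cst c = Poly_Mapping.single 0 c"

definition X :: "'n \<Rightarrow> ('n, 'k::zero_neq_one) mpol"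
  where "X i = Poly_Mapping.single (Poly_Mapping.single i 1) 1"

definition polys_in :: "'n set \<Rightarrow> ('n, 'k::zero) mpol set"
  where "polys_in S = {p. \<forall>m \<in> Poly_Mapping.keys p. Poly_Mapping.keys m \<subseteq> S}"

definition pdiff :: "'n \<Rightarrow> ('n, 'k::comm_ring_1) mpol \<Rightarrow> ('n, 'k) mpol"
  where "pdiff j p = (\<Sum>m \<in> Poly_Mapping.keys p.
    Poly_Mapping.single (m - Poly_Mapping.single j 1)
      (of_nat (Poly_Mapping.lookup m j) * Poly_Mapping.lookup p m))"

text \<open>\<open>psubst f p\<close> is \<open>p\<close> with every variable \<open>X i\<close> replaced by \<open>f i\<close>.\<close>

definition psubst ::
  "('n::finite \<Rightarrow> ('n, 'k::comm_ring_1) mpol) \<Rightarrow> ('n, 'k) mpol \<Rightarrow> ('n, 'k) mpol"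
  where "psubst f p = (\<Sum>m \<in> Poly_Mapping.keys p.
    Cst (Poly_Mapping.lookup p m) * (\<Prod>i\<in>UNIV. f i ^ Poly_Mapping.lookup m i))"

text \<open>
  A polynomial endomorphism of affine space is the family of its components; \<open>pcomp f g\<close> is the
  map \<open>f \<circ> g\<close>, and the ring endomorphism corresponding to \<open>f\<close> is \<open>psubst f\<close>, which sends
  \<open>X i\<close> to \<open>f i\<close>.
\<close>

type_synonym ('n, 'k) pendo = "'n \<Rightarrow> ('n, 'k) mpol"

definition pcomp ::
  "('n::finite, 'k::comm_ring_1) pendo \<Rightarrow> ('n, 'k) pendo \<Rightarrow> ('n, 'k) pendo"
  where "pcomp f g = (\<lambda>i. psubst g (f i))"

definition jacobian_det :: "('n::finite, 'k::comm_ring_1) pendo \<Rightarrow> ('n, 'k) mpol"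
  where "jacobian_det f = det (\<chi> i j. pdiff j (f i))"

definition GA :: "('n::finite, 'k::field) pendo monoid"
  where "GA = \<lparr>carrier = {f. \<exists>g. pcomp f g = X \<and> pcomp g f = X}, monoid.mult = pcomp, one = X\<rparr>"

definition SA :: "('n::finite, 'k::field) pendo monoid"
  where "SA = GA\<lparr>carrier := {f \<in> carrier GA. jacobian_det f = 1}\<rparr>"

definition normal_closure :: "('a, 'b) monoid_scheme \<Rightarrow> 'a set \<Rightarrow> 'a set"
  where "normal_closure G H = \<Inter> {N. N \<lhd> G \<and> H \<subseteq> N}"

definition linear_endo :: "'k::field ^ 'n ^ 'n \<Rightarrow> ('n::finite, 'k) pendo"
  where "linear_endo A = (\<lambda>i. \<Sum>j\<in>UNIV. Cst (A $ i $ j) * X j)"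

definition SL :: "('n::finite, 'k::field) pendo set"
  where "SL = {linear_endo A | A. det A = 1}"

definition SLIN :: "('n::finite, 'k::field) pendo set"
  where "SLIN = normal_closure SA SL"

definition normally_cotame :: "('n::finite, 'k::field) pendo \<Rightarrow> bool"
  where "normally_cotame \<theta> \<longleftrightarrow> \<theta> \<in> carrier SA \<and> SLIN \<subseteq> normal_closure SA {\<theta>}"

definition derivation :: "(('n, 'k::field) mpol \<Rightarrow> ('n, 'k) mpol) \<Rightarrow> bool"
  where "derivation D \<longleftrightarrow>
    (\<forall>p q. D (p + q) = D p + D q) \<and>
    (\<forall>c p. D (Cst c * p) = Cst c * D p) \<and>
    (\<forall>p q. D (p * q) = D p * q + p * D q)"

definition triangular_derivation ::
  "(('n::{finite,linorder}, 'k::field) mpol \<Rightarrow> ('n, 'k) mpol) \<Rightarrow> bool"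
  where "triangular_derivation D \<longleftrightarrow> derivation D \<and> (\<forall>i. D (X i) \<in> polys_in {..<i})"

text \<open>
  \<open>Sum_any\<close> sums over the indices with nonzero summand and is \<open>0\<close> if there are infinitely many of
  them; for locally nilpotent \<open>E\<close> the support is finite, so \<open>exp_der E\<close> is then the usual
  exponential.
\<close>

definition exp_der ::
  "(('n, 'k::field_char_0) mpol \<Rightarrow> ('n, 'k) mpol) \<Rightarrow> ('n, 'k) mpol \<Rightarrow> ('n, 'k) mpol"
  where "exp_der E p = Sum_any (\<lambda>k. Cst (1 / fact k) * (E ^^ k) p)"

definition exp_aut ::
  "(('n, 'k::field_char_0) mpol \<Rightarrow> ('n, 'k) mpol) \<Rightarrow> ('n, 'k) pendo"
  where "exp_aut E = (\<lambda>i. exp_der E (X i))"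

end

theory Submission
  imports Defs "HOL-Computational_Algebra.Polynomial"
begin

text \<open>
  If \<open>\<phi> \<in> SA\<close> commutes with the locally nilpotent derivation \<open>D\<close> and \<open>D F = 0\<close>, then the commutator
  of \<open>\<phi>\<close> with \<open>exp(F D)\<close> is \<open>exp((\<phi>(F) - F) D)\<close>; it lies in a normal subgroup \<open>N\<close> as soon as one of
  the two factors does. Write \<open>\<partial>\<^sub>i\<close> for the partial derivatives and let \<open>exp(F D) \<in> N\<close> with \<open>D\<close>
  triangular. As \<open>D\<close> commutes with \<open>\<partial>\<^sub>n\<close>, commutators with translations along \<open>x\<^sub>n\<close> take differences
  of \<open>F\<close> until \<open>\<partial>\<^sub>n F = 0\<close>. Let \<open>m\<close> be minimal with \<open>D x\<^sub>m \<noteq> 0\<close>. If \<open>m < n\<close>, the commutator of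
  \<open>exp(F D)\<close> with \<open>exp(x\<^sub>m \<partial>\<^sub>n)\<close> shows that \<open>exp(H \<partial>\<^sub>n) \<in> N\<close> for \<open>H = F D x\<^sub>m\<close>; if \<open>m = n\<close>, then
  \<open>exp(F D)\<close> is already of this form. Differences in all directions make \<open>H\<close> a nonzero constant, so
  \<open>N\<close> contains a translation, hence, by commutators with linear maps, all of them. The commutator of
  \<open>exp((a/2) x\<^sub>j\<^sup>2 \<partial>\<^sub>i)\<close> with a translation along \<open>x\<^sub>j\<close> is a transvection up to translation, and
  transvections generate \<open>SL\<^sub>n\<close>.
\<close>

section \<open>Polynomials, substitution and partial derivatives\<close>

lemma Cst_0 [simp]: "Cst 0 = 0"
  by (simp add: Cst_def)

lemma Cst_1 [simp]: "Cst 1 = 1"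
  by (simp add: Cst_def)

lemma Cst_add: "Cst (a + b) = Cst a + Cst b"
  by (simp add: Cst_def single_add)

lemma Cst_mult: "Cst (a * b) = Cst a * Cst b"
  by (simp add: Cst_def mult_single)

lemma Cst_minus: "Cst (- a :: 'k::comm_ring_1) = - Cst a"
  by (simp add: Cst_def single_uminus)

lemma Cst_eq_iff [simp]: "Cst a = Cst b \<longleftrightarrow> a = b"
  by (metis Cst_def lookup_single_eq)

lemma Cst_of_nat: "Cst (of_nat n :: 'k::comm_ring_1) = of_nat n"
  by (simp add: Cst_def)

lemma X_power: "X i ^ k = Poly_Mapping.single (Poly_Mapping.single i k) 1"
  by (induction k) (simp_all add: X_def mult_single flip: single_add)

lemma prod_single_1:
  "(\<Prod>i\<in>A. Poly_Mapping.single (f i) (1::'k::comm_ring_1)) = Poly_Mapping.single (\<Sum>i\<in>A. f i) 1"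
  by (induction A rule: infinite_finite_induct) (simp_all add: mult_single)

lemma exponent_expand: "(\<Sum>i\<in>UNIV. Poly_Mapping.single i (Poly_Mapping.lookup m i)) = (m :: 'n::finite \<Rightarrow>\<^sub>0 nat)"
proof (rule poly_mapping_eqI)
  fix k
  show "Poly_Mapping.lookup (\<Sum>i\<in>UNIV. Poly_Mapping.single i (Poly_Mapping.lookup m i)) k = Poly_Mapping.lookup m k"
    by (simp add: lookup_sum lookup_single when_def)
qed

lemma single_eq_monomial:
  "Poly_Mapping.single m (c::'k::comm_ring_1) = Cst c * (\<Prod>i\<in>(UNIV::'n::finite set). X i ^ Poly_Mapping.lookup m i)"
  by (simp add: X_power prod_single_1 exponent_expand Cst_def mult_single)

lemma mpol_expand: "p = (\<Sum>m\<in>Poly_Mapping.keys p. Poly_Mapping.single m (Poly_Mapping.lookup p m))"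
proof (rule poly_mapping_eqI)
  fix k
  show "Poly_Mapping.lookup p k = Poly_Mapping.lookup (\<Sum>m\<in>Poly_Mapping.keys p. Poly_Mapping.single m (Poly_Mapping.lookup p m)) k"
    by (cases "k \<in> Poly_Mapping.keys p") (simp_all add: lookup_sum lookup_single when_def in_keys_iff)
qed

text \<open>Every element of \<open>polys_in S\<close> is a sum of monomials in variables from
  \<open>S\<close>. Identities of ring homomorphisms and derivations thus reduce to constants and
  variables, with no coefficient sums left.\<close>

lemma polys_in_induct [consumes 1, case_names Cst X add mult]:
  fixes p :: "('n::finite, 'k::comm_ring_1) mpol"
  assumes p: "p \<in> polys_in S"
    and C: "\<And>c. P (Cst c)" and V: "\<And>i. i \<in> S \<Longrightarrow> P (X i)"
    and A: "\<And>p q. P p \<Longrightarrow> P q \<Longrightarrow> P (p + q)" and M: "\<And>p q. P p \<Longrightarrow> P q \<Longrightarrow> P (p * q)"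
  shows "P p"
proof -
  have pow: "P (X i ^ k)" if "i \<in> S" for i k
    using C[of 1] by (induction k) (auto intro: M V that)
  have mono: "P (\<Prod>i\<in>T. X i ^ Poly_Mapping.lookup m i)" if "Poly_Mapping.keys m \<subseteq> S" for m T
  proof (induction T rule: infinite_finite_induct)
    case (insert i T)
    have "P (X i ^ Poly_Mapping.lookup m i)"
    proof (cases "i \<in> S")
      case False
      then have "Poly_Mapping.lookup m i = 0" using that by (auto simp: in_keys_iff)
      then show ?thesis using C[of 1] by simp
    qed (rule pow)
    with insert show ?case by (auto intro: M)
  qed (use C[of 1] in auto)
  have "P (\<Sum>m\<in>M'. Poly_Mapping.single m (Poly_Mapping.lookup p m))" if "M' \<subseteq> Poly_Mapping.keys p" for M'
    using finite_subset[OF that finite_keys] that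
  proof (induction M' rule: finite_induct)
    case empty
    then show ?case using C[of 0] by simp
  next
    case (insert m M')
    moreover have "P (Poly_Mapping.single m (Poly_Mapping.lookup p m))"
      using p insert.prems unfolding single_eq_monomial polys_in_def by (auto intro!: M C mono)
    ultimately show ?case by (auto intro: A)
  qed
  then show ?thesis using mpol_expand[of p] by (metis order_refl)
qed

lemma mpol_induct [case_names Cst X add mult]:
  fixes p :: "('n::finite, 'k::comm_ring_1) mpol"
  assumes "\<And>c. P (Cst c)" "\<And>i. P (X i)"
    and "\<And>p q. P p \<Longrightarrow> P q \<Longrightarrow> P (p + q)" "\<And>p q. P p \<Longrightarrow> P q \<Longrightarrow> P (p * q)"
  shows "P p"
  using polys_in_induct[of p UNIV P] assms by (auto simp: polys_in_def)

lemma sum_keys_superset: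
  assumes "finite S" "Poly_Mapping.keys p \<subseteq> S" "\<And>m. g m 0 = 0"
  shows "(\<Sum>m\<in>Poly_Mapping.keys p. g m (Poly_Mapping.lookup p m)) = (\<Sum>m\<in>S. g m (Poly_Mapping.lookup p m))"
  using assms by (intro sum.mono_neutral_left) (auto simp: in_keys_iff)

text \<open>Cancellation can make \<open>keys (p + q)\<close> smaller than the union of the two key
  sets, so all three sums are first extended to the union by zero terms. Both \<open>psubst\<close>
  and \<open>pdiff\<close> have this shape.\<close>

lemma sum_keys_add:
  assumes "\<And>m. g m 0 = 0" "\<And>m a b. g m (a + b) = g m a + g m b"
  shows "(\<Sum>m\<in>Poly_Mapping.keys (p + q). g m (Poly_Mapping.lookup (p + q) m)) =
    (\<Sum>m\<in>Poly_Mapping.keys p. g m (Poly_Mapping.lookup p m)) + (\<Sum>m\<in>Poly_Mapping.keys q. g m (Poly_Mapping.lookup q m))"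
proof -
  let ?S = "Poly_Mapping.keys p \<union> Poly_Mapping.keys q"
  have 1: "Poly_Mapping.keys (p + q) \<subseteq> ?S" by (rule keys_add)
  show ?thesis
    using sum_keys_superset[of ?S "p + q" g, OF _ 1 assms(1)] sum_keys_superset[of ?S p g, OF _ _ assms(1)]
      sum_keys_superset[of ?S q g, OF _ _ assms(1)]
    by (simp add: lookup_add assms(2) sum.distrib)
qed

section \<open>Substitution as a ring homomorphism\<close>

lemma psubst_add: "psubst f (p + q) = psubst f p + psubst f q"
  unfolding psubst_def
  by (rule sum_keys_add[where g = "\<lambda>m c. Cst c * (\<Prod>i\<in>UNIV. f i ^ Poly_Mapping.lookup m i)"])
    (auto simp: Cst_add algebra_simps)

lemma psubst_single: "psubst f (Poly_Mapping.single m c) = Cst c * (\<Prod>i\<in>UNIV. f i ^ Poly_Mapping.lookup m i)"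
  by (simp add: psubst_def)

lemma psubst_Cst [simp]: "psubst f (Cst c) = Cst c"
  by (simp add: Cst_def[of c] psubst_single)

lemma psubst_0 [simp]: "psubst f 0 = 0"
  by (simp add: psubst_def)

lemma psubst_1 [simp]: "psubst f 1 = 1"
  using psubst_Cst[of f 1] by simp

lemma psubst_X [simp]: "psubst f (X i) = f i"
proof -
  have "(\<Prod>j\<in>UNIV. f j ^ Poly_Mapping.lookup (Poly_Mapping.single i (1::nat)) j) = (\<Prod>j\<in>UNIV. if j = i then f j else 1)"
    by (rule prod.cong) (auto simp: lookup_single when_def)
  then show ?thesis
    by (simp add: X_def psubst_single)
qed

lemma psubst_sum: "psubst f (sum g A) = (\<Sum>a\<in>A. psubst f (g a))"
  by (induction A rule: infinite_finite_induct) (simp_all add: psubst_add)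

lemma psubst_mult: "psubst f (p * q) = psubst f p * psubst f q"
proof -
  have single: "psubst f (Poly_Mapping.single m c * Poly_Mapping.single m' c')
      = psubst f (Poly_Mapping.single m c) * psubst f (Poly_Mapping.single m' c')" for m m' c c'
    by (simp add: mult_single psubst_single lookup_add power_add prod.distrib Cst_mult algebra_simps)
  have "psubst f (sum (\<lambda>m. Poly_Mapping.single m (a m)) A * sum (\<lambda>m. Poly_Mapping.single m (b m)) B)
      = psubst f (sum (\<lambda>m. Poly_Mapping.single m (a m)) A) * psubst f (sum (\<lambda>m. Poly_Mapping.single m (b m)) B)"
    for a b A B
    by (simp add: sum_product psubst_sum single)
  from this[of "Poly_Mapping.lookup p" "Poly_Mapping.keys p" "Poly_Mapping.lookup q" "Poly_Mapping.keys q"]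
  show ?thesis
    using mpol_expand[of p] mpol_expand[of q] by simp
qed

lemma psubst_prod: "psubst f (prod g A) = (\<Prod>a\<in>A. psubst f (g a))"
  by (induction A rule: infinite_finite_induct) (simp_all add: psubst_mult)

lemma psubst_of_int [simp]: "psubst f (of_int z) = of_int z"
  using psubst_Cst[of f "of_int z"] by (simp add: Cst_def)

lemma psubst_pcomp: "psubst (pcomp f g) p = psubst g (psubst f p)"
  by (induction p rule: mpol_induct) (simp_all add: psubst_add psubst_mult pcomp_def)

lemma psubst_ident [simp]: "psubst X p = p"
  by (induction p rule: mpol_induct) (simp_all add: psubst_add psubst_mult)

lemma pcomp_X [simp]: "pcomp f X = f" "pcomp X f = f"
  by (auto simp: pcomp_def)

lemma pcomp_assoc: "pcomp (pcomp f g) h = pcomp f (pcomp g h)"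
  by (simp add: pcomp_def psubst_pcomp[unfolded pcomp_def])

section \<open>Partial derivatives, the chain rule and Jacobian determinants\<close>

lemma pdiff_add: "pdiff j (p + q) = pdiff j p + pdiff j q"
  unfolding pdiff_def
  by (rule sum_keys_add[where g = "\<lambda>m c. Poly_Mapping.single (m - Poly_Mapping.single j 1)
      (of_nat (Poly_Mapping.lookup m j) * c)"]) (auto simp: single_add algebra_simps)

lemma pdiff_single:
  "pdiff j (Poly_Mapping.single m c) = Poly_Mapping.single (m - Poly_Mapping.single j 1) (of_nat (Poly_Mapping.lookup m j) * c)"
  by (simp add: pdiff_def)

lemma pdiff_0 [simp]: "pdiff j 0 = 0"
  by (simp add: pdiff_def)

lemma pdiff_Cst [simp]: "pdiff j (Cst c) = 0"
  by (simp add: Cst_def pdiff_single)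

lemma pdiff_X: "pdiff j (X i) = (if i = j then 1 else 0)"
  by (auto simp: X_def pdiff_single lookup_single)

lemma pdiff_sum: "pdiff j (sum g A) = (\<Sum>a\<in>A. pdiff j (g a))"
  by (induction A rule: infinite_finite_induct) (simp_all add: pdiff_add)

lemma pdiff_mult:
  fixes p q :: "('n, 'k::comm_ring_1) mpol"
  shows "pdiff j (p * q) = pdiff j p * q + p * pdiff j q"
proof -
  \<comment> \<open>Subtraction of exponents is truncated, so the two exponents may differ if
    \<open>j\<close> does not occur in \<open>m\<close>; in that case the coefficient is
    \<open>0\<close> on both sides.\<close>
  have aux: "Poly_Mapping.single (m - Poly_Mapping.single j 1 + m') (of_nat (Poly_Mapping.lookup m j) * c)
    = Poly_Mapping.single (m + m' - Poly_Mapping.single j 1) (of_nat (Poly_Mapping.lookup m j) * c)"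
    for m m' :: "'n \<Rightarrow>\<^sub>0 nat" and c :: 'k
  proof (cases "Poly_Mapping.lookup m j = 0")
    case False
    then have "m - Poly_Mapping.single j 1 + m' = m + m' - Poly_Mapping.single j 1"
      by (intro poly_mapping_eqI) (auto simp: lookup_add lookup_minus lookup_single when_def)
    then show ?thesis by simp
  qed simp
  have single: "pdiff j (Poly_Mapping.single m c * Poly_Mapping.single m' c')
      = pdiff j (Poly_Mapping.single m c) * Poly_Mapping.single m' c' + Poly_Mapping.single m c * pdiff j (Poly_Mapping.single m' c')"
    for m m' :: "'n \<Rightarrow>\<^sub>0 nat" and c c' :: 'k
    using aux[of m m' "c * c'"] aux[of m' m "c * c'"]
    by (simp add: mult_single pdiff_single lookup_add algebra_simps single_add)
  have "pdiff j (sum (\<lambda>m. Poly_Mapping.single m (a m)) A * sum (\<lambda>m. Poly_Mapping.single m (b m)) B)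
      = pdiff j (sum (\<lambda>m. Poly_Mapping.single m (a m)) A) * sum (\<lambda>m. Poly_Mapping.single m (b m)) B
       + sum (\<lambda>m. Poly_Mapping.single m (a m)) A * pdiff j (sum (\<lambda>m. Poly_Mapping.single m (b m)) B)"
    for a b :: "('n \<Rightarrow>\<^sub>0 nat) \<Rightarrow> 'k" and A B
    by (simp add: sum_product pdiff_sum single sum.distrib)
  from this[of "Poly_Mapping.lookup p" "Poly_Mapping.keys p" "Poly_Mapping.lookup q" "Poly_Mapping.keys q"]
  show ?thesis
    using mpol_expand[of p] mpol_expand[of q] by simp
qed

lemma derivation_pdiff: "derivation (pdiff j)"
  by (simp add: derivation_def pdiff_add pdiff_mult)

lemma chain_rule: "pdiff j (psubst g p) = (\<Sum>i\<in>UNIV. psubst g (pdiff i p) * pdiff j (g i))"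
proof (induction p rule: mpol_induct)
  case (X k)
  show ?case by (simp add: pdiff_X if_distrib[of "psubst g"] if_distrib[of "\<lambda>x. x * y" for y] cong: if_cong)
next
  case (mult p q)
  then show ?case
    by (simp add: psubst_mult psubst_add pdiff_mult sum.distrib sum_distrib_left sum_distrib_right algebra_simps)
qed (simp_all add: psubst_add pdiff_add sum.distrib algebra_simps)

lemma psubst_det: "psubst g (det A) = det (\<chi> i j. psubst g (A $ i $ j))"
  by (simp add: det_def psubst_sum psubst_mult psubst_prod)

lemma jacobian_det_pcomp: "jacobian_det (pcomp f g) = psubst g (jacobian_det f) * jacobian_det g"
proof -
  have "(\<chi> i j. pdiff j (pcomp f g i)) = (\<chi> i j. psubst g (pdiff j (f i))) ** (\<chi> i j. pdiff j (g i))"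
    by (simp add: vec_eq_iff matrix_matrix_mult_def pcomp_def chain_rule)
  then show ?thesis
    by (simp add: jacobian_det_def det_mul psubst_det)
qed

lemma jacobian_det_X [simp]: "jacobian_det X = 1"
proof -
  have "(\<chi> i j. pdiff j (X i)) = (mat 1 :: ('a,'b) mpol ^ 'a ^ 'a)"
    by (simp add: vec_eq_iff mat_def pdiff_X)
  then show ?thesis by (simp add: jacobian_det_def)
qed

section \<open>Locally nilpotent derivations and their exponentials\<close>

lemma derivation_add: "derivation D \<Longrightarrow> D (p + q) = D p + D q"
  unfolding derivation_def by blast

lemma derivation_mult: "derivation D \<Longrightarrow> D (p * q) = D p * q + p * D q"
  unfolding derivation_def by blast

lemma derivation_scale: "derivation D \<Longrightarrow> D (Cst c * p) = Cst c * D p"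
  unfolding derivation_def by blast

lemma derivation_0: "derivation D \<Longrightarrow> D 0 = 0"
  using derivation_add[of D 0 0] by simp

lemma derivation_1: "derivation D \<Longrightarrow> D 1 = 0"
  using derivation_mult[of D 1 1] by simp

lemma derivation_Cst: "derivation D \<Longrightarrow> D (Cst c) = 0"
  using derivation_scale[of D c 1] derivation_1[of D] by simp

lemma derivation_minus: "derivation D \<Longrightarrow> D (- p) = - D p"
  using derivation_add[of D p "- p"] derivation_0[of D] by (simp add: eq_neg_iff_add_eq_0 add.commute)

lemma derivation_diff: "derivation D \<Longrightarrow> D (p - q) = D p - D q"
  using derivation_add[of D p "- q"] derivation_minus[of D q] by simp

lemma derivation_sum: "derivation D \<Longrightarrow> D (sum g A) = (\<Sum>a\<in>A. D (g a))"
proof (induction A rule: infinite_finite_induct)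
  case (insert x F)
  then show ?case using derivation_add[OF insert.prems] by simp
qed (simp_all add: derivation_0[of D])

lemma derivation_power_ker:
  assumes D: "derivation D" and "D F = 0"
  shows "D (F ^ k) = 0"
  by (induction k) (simp_all add: derivation_mult[OF D] derivation_1[OF D] assms(2))

lemma derivation_polys_in:
  fixes p :: "('n::finite, 'k::field) mpol"
  assumes D: "derivation D" and "\<And>i. i \<in> S \<Longrightarrow> D (X i) = 0" "p \<in> polys_in S"
  shows "D p = 0"
  using assms(3)
  by (induction p rule: polys_in_induct)
    (simp_all add: assms(2) derivation_Cst[OF D] derivation_add[OF D] derivation_mult[OF D])

text \<open>Both sides are derivations along the ring homomorphism \<open>psubst g\<close>, hence
  determined by their values on the variables.\<close>

lemma derivation_along_ext:
  fixes p :: "('n::finite, 'k::field) mpol"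
  assumes D: "derivation D" and E: "derivation E"
    and X: "\<And>i. psubst g (D (X i)) = E (psubst g (X i))"
  shows "psubst g (D p) = E (psubst g p)"
proof (induction p rule: mpol_induct)
  case (X i)
  then show ?case by (rule assms(3))
qed (simp_all add: derivation_Cst[OF D] derivation_add[OF D] derivation_mult[OF D]
    derivation_Cst[OF E] derivation_add[OF E] derivation_mult[OF E] psubst_add psubst_mult)

lemma derivation_ext:
  fixes p :: "('n::finite, 'k::field) mpol"
  assumes "derivation D" "derivation E" "\<And>i. D (X i) = E (X i)"
  shows "D p = E p"
  using derivation_along_ext[of D E X p] assms by simp

text \<open>The commutator \<open>D E - E D\<close> is again a derivation, so it vanishes once it
  vanishes on the variables.\<close>

lemma derivations_commute:
  fixes p :: "('n::finite, 'k::field) mpol"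
  assumes D: "derivation D" and E: "derivation E" and "\<And>i. D (E (X i)) = E (D (X i))"
  shows "D (E p) = E (D p)"
proof (induction p rule: mpol_induct)
  case (X i)
  then show ?case by (rule assms(3))
qed (simp_all add: derivation_Cst[OF D] derivation_add[OF D] derivation_mult[OF D] derivation_0[OF D]
    derivation_Cst[OF E] derivation_add[OF E] derivation_mult[OF E] derivation_0[OF E])

lemma derivation_mult_left:
  assumes D: "derivation D"
  shows "derivation (\<lambda>p. F * D p)"
  unfolding derivation_def
proof (intro conjI allI)
  show "F * D (p + q) = F * D p + F * D q" for p q
    by (simp add: derivation_add[OF D] distrib_left)
  show "F * D (Cst c * p) = Cst c * (F * D p)" for c p
    by (simp add: derivation_scale[OF D] mult.left_commute)
  show "F * D (p * q) = F * D p * q + p * (F * D q)" for p q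
    by (simp add: derivation_mult[OF D] algebra_simps)
qed

lemma funpow_scale:
  assumes D: "derivation D"
  shows "(D ^^ k) (Cst c * p) = Cst c * (D ^^ k) p"
  by (induction k) (simp_all add: derivation_scale[OF D])

lemma funpow_add_arg:
  assumes D: "derivation D"
  shows "(D ^^ k) (p + q) = (D ^^ k) p + (D ^^ k) q"
  by (induction k) (simp_all add: derivation_add[OF D])

lemma funpow_derivation_0:
  assumes D: "derivation D"
  shows "(D ^^ k) 0 = 0"
  by (induction k) (simp_all add: derivation_0[OF D])

lemma funpow_eq_0_mono:
  assumes D: "derivation D" and "(D ^^ m) p = 0" "m \<le> n"
  shows "(D ^^ n) p = 0"
proof -
  have "(D ^^ (n - m + m)) p = 0"
    unfolding funpow_add using assms(2) by (simp add: funpow_derivation_0[OF D])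
  then show ?thesis using assms(3) by simp
qed

text \<open>The divided powers of \<open>D\<close>; in this normalisation the Leibniz rule has no
  binomial coefficients and becomes the product rule for coefficients of polynomials.\<close>

definition dpow ::
  "(('n, 'k::field_char_0) mpol \<Rightarrow> ('n, 'k) mpol) \<Rightarrow> nat \<Rightarrow> ('n, 'k) mpol \<Rightarrow> ('n, 'k) mpol"
  where "dpow D k p = Cst (1 / fact k) * (D ^^ k) p"

lemma dpow_0 [simp]: "dpow D 0 p = p"
  by (simp add: dpow_def)

lemma dpow_add: "derivation D \<Longrightarrow> dpow D k (p + q) = dpow D k p + dpow D k q"
  by (simp add: dpow_def funpow_add_arg[of D] distrib_left)

lemma dpow_Cst: "derivation D \<Longrightarrow> dpow D k (Cst c) = (if k = 0 then Cst c else 0)"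
  by (cases k) (simp_all add: dpow_def funpow_derivation_0[of D] derivation_Cst[of D] funpow_swap1)

lemma Cst_mult_left: "Cst (a * b) * p = Cst a * (Cst b * p)"
  by (simp add: Cst_mult mult.assoc)

lemma dpow_dpow:
  fixes D :: "('n, 'k::field_char_0) mpol \<Rightarrow> ('n, 'k) mpol"
  assumes D: "derivation D"
  shows "dpow D j (dpow D k p) = of_nat ((j + k) choose k) * dpow D (j + k) p"
proof -
  have "(1 / fact j) * (1 / fact k) = (of_nat ((j + k) choose k) * (1 / fact (j + k)) :: 'k)"
    by (simp add: binomial_fact)
  then have "Cst ((1 / fact j) * (1 / fact k) :: 'k) * (D ^^ (j + k)) p
    = Cst (of_nat ((j + k) choose k) * (1 / fact (j + k))) * (D ^^ (j + k)) p"
    by simp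
  then show ?thesis
    by (simp only: dpow_def funpow_scale[OF D] funpow_add o_apply Cst_mult_left Cst_of_nat)
qed

lemma derivation_dpow:
  assumes "derivation D"
  shows "D (dpow D k p) = of_nat (Suc k) * dpow D (Suc k) p"
  using dpow_dpow[OF assms, of 1 k p] by (simp add: dpow_def)

lemma of_nat_Suc_cancel:
  assumes "of_nat (Suc k) * p = of_nat (Suc k) * (q :: ('n, 'k::field_char_0) mpol)"
  shows "p = q"
proof -
  have "Cst (1 / of_nat (Suc k)) * of_nat (Suc k) = (1 :: ('n, 'k) mpol)"
    by (metis Cst_1 Cst_mult Cst_of_nat nonzero_divide_eq_eq of_nat_neq_0)
  then show ?thesis
    using arg_cong[OF assms, of "\<lambda>x. Cst (1 / of_nat (Suc k)) * x"]
    by (simp only: mult.assoc[symmetric] mult_1)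
qed

text \<open>Applying \<open>D\<close> to the convolution for \<open>k\<close> gives
  \<open>Suc k\<close> times the convolution for \<open>Suc k\<close>; the factor cancels in
  characteristic zero.\<close>

lemma dpow_mult:
  assumes D: "derivation D"
  shows "dpow D k (p * q) = (\<Sum>i\<le>k. dpow D i p * dpow D (k - i) q)"
proof (induction k)
  case (Suc k)
  let ?a = "\<lambda>i. dpow D i p" and ?b = "\<lambda>i. dpow D i q"
  have "of_nat (Suc k) * dpow D (Suc k) (p * q) = D (\<Sum>i\<le>k. ?a i * ?b (k - i))"
    by (simp only: derivation_dpow[OF D, symmetric] Suc)
  also have "\<dots> = (\<Sum>i\<le>k. of_nat (Suc i) * ?a (Suc i) * ?b (k - i)) + (\<Sum>i\<le>k. of_nat (Suc (k - i)) * ?a i * ?b (Suc (k - i)))"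
    by (simp only: derivation_sum[OF D] derivation_mult[OF D] derivation_dpow[OF D] sum.distrib ac_simps)
  \<comment> \<open>Both sums are extended to \<open>i \<le> Suc k\<close>, the first after an index
    shift. The new terms, \<open>i = 0\<close> in the first and \<open>i = Suc k\<close> in the
    second, have coefficient \<open>0\<close>.\<close>
  also have "(\<Sum>i\<le>k. of_nat (Suc i) * ?a (Suc i) * ?b (k - i)) = (\<Sum>i\<le>Suc k. of_nat i * ?a i * ?b (Suc k - i))"
    by (subst sum.atMost_Suc_shift) simp
  also have "(\<Sum>i\<le>k. of_nat (Suc (k - i)) * ?a i * ?b (Suc (k - i))) = (\<Sum>i\<le>Suc k. of_nat (Suc k - i) * ?a i * ?b (Suc k - i))"
    by (simp add: Suc_diff_le del: of_nat_Suc of_nat_diff)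
  also have "(\<Sum>i\<le>Suc k. of_nat i * ?a i * ?b (Suc k - i)) + (\<Sum>i\<le>Suc k. of_nat (Suc k - i) * ?a i * ?b (Suc k - i))
      = (\<Sum>i\<le>Suc k. of_nat (Suc k) * (?a i * ?b (Suc k - i)))"
    unfolding sum.distrib[symmetric]
  proof (rule sum.cong[OF refl])
    fix i assume "i \<in> {..Suc k}"
    then have "(of_nat (Suc k) :: ('a, 'b) mpol) = of_nat i + of_nat (Suc k - i)"
      by (simp only: of_nat_add[symmetric]) simp
    then show "of_nat i * ?a i * ?b (Suc k - i) + of_nat (Suc k - i) * ?a i * ?b (Suc k - i) =
      of_nat (Suc k) * (?a i * ?b (Suc k - i))"
      by (simp only: distrib_right mult.assoc)
  qed
  also have "\<dots> = of_nat (Suc k) * (\<Sum>i\<le>Suc k. ?a i * ?b (Suc k - i))"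
    by (simp only: sum_distrib_left)
  finally show ?case by (rule of_nat_Suc_cancel)
qed simp

section \<open>Exponentials as evaluated Taylor polynomials\<close>

definition lnd :: "(('n, 'k::field) mpol \<Rightarrow> ('n, 'k) mpol) \<Rightarrow> bool"
  where "lnd D \<longleftrightarrow> derivation D \<and> (\<forall>p. \<exists>n. (D ^^ n) p = 0)"

lemma lnd_derivation: "lnd D \<Longrightarrow> derivation D"
  by (simp add: lnd_def)

text \<open>The polynomial \<open>\<Sum>\<^sub>k T\<^sup>k D\<^sup>k(p) / k!\<close> in a new variable \<open>T\<close>: evaluating it at \<open>F\<close> in the kernel
  of \<open>D\<close> gives \<open>exp(F D)(p)\<close>, and the Leibniz rule makes it multiplicative in \<open>p\<close>.\<close>

definition taylor ::
  "(('n, 'k::field_char_0) mpol \<Rightarrow> ('n, 'k) mpol) \<Rightarrow> ('n, 'k) mpol \<Rightarrow> ('n, 'k) mpol poly"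
  where "taylor D p = Abs_poly (\<lambda>k. dpow D k p)"

lemma dpow_eventually_0:
  assumes "lnd D"
  shows "\<exists>N. \<forall>k\<ge>N. dpow D k p = 0"
proof -
  obtain N where "(D ^^ N) p = 0"
    using assms by (auto simp: lnd_def)
  then have "dpow D k p = 0" if "k \<ge> N" for k
    using funpow_eq_0_mono[OF lnd_derivation[OF assms]] that by (simp add: dpow_def)
  then show ?thesis by blast
qed

lemma coeff_taylor: "lnd D \<Longrightarrow> coeff (taylor D p) = (\<lambda>k. dpow D k p)"
  unfolding taylor_def
  using dpow_eventually_0[of D p] by (metis coeff_Abs_poly less_imp_le)

lemma taylor_add: "lnd D \<Longrightarrow> taylor D (p + q) = taylor D p + taylor D q"
  by (rule poly_eqI) (simp add: coeff_taylor dpow_add[of D] lnd_derivation[of D])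

lemma taylor_mult: "lnd D \<Longrightarrow> taylor D (p * q) = taylor D p * taylor D q"
  by (rule poly_eqI) (simp add: coeff_taylor coeff_mult dpow_mult[of D] lnd_derivation[of D])

lemma taylor_Cst: "lnd D \<Longrightarrow> taylor D (Cst c) = [:Cst c:]"
  by (rule poly_eqI) (simp add: coeff_taylor dpow_Cst[of D] lnd_derivation[of D] coeff_pCons split: nat.split)

lemma poly_eq_sum_lessThan:
  assumes "\<And>k. k \<ge> N \<Longrightarrow> coeff p k = 0"
  shows "poly p (x :: 'a::comm_semiring_1) = (\<Sum>k<N. coeff p k * x ^ k)"
proof -
  have "(\<Sum>k\<le>degree p. coeff p k * x ^ k) = (\<Sum>k<N. coeff p k * x ^ k)"
  proof (rule sum.mono_neutral_cong)
    fix i assume "i \<in> {..<N} - {..degree p}"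
    then show "coeff p i * x ^ i = 0" by (simp add: coeff_eq_0)
  next
    fix i assume "i \<in> {..degree p} - {..<N}"
    then show "coeff p i * x ^ i = 0" by (simp add: assms)
  qed auto
  then show ?thesis by (simp add: poly_altdef)
qed

lemma poly_taylor:
  assumes "lnd D" "\<And>k. k \<ge> N \<Longrightarrow> dpow D k p = 0"
  shows "poly (taylor D p) F = (\<Sum>k<N. dpow D k p * F ^ k)"
  using poly_eq_sum_lessThan[of N "taylor D p" F] assms by (simp add: coeff_taylor)

lemma funpow_ker_mult:
  assumes D: "derivation D" and F: "D F = 0"
  shows "((\<lambda>p. F * D p) ^^ k) p = F ^ k * (D ^^ k) p"
  by (induction k) (simp_all add: derivation_mult[OF D] derivation_power_ker[OF D F] mult.assoc)

text \<open>Since \<open>F\<close> is in the kernel of \<open>D\<close>, the powers of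
  \<open>F D\<close> are \<open>F ^ k * D ^^ k\<close>, and the exponential series is the Taylor
  polynomial evaluated at \<open>F\<close>.\<close>

lemma exp_der_eq_poly:
  assumes D: "lnd D" and F: "D F = 0"
  shows "exp_der (\<lambda>p. F * D p) p = poly (taylor D p) F"
proof -
  obtain N where N: "\<And>k. k \<ge> N \<Longrightarrow> dpow D k p = 0"
    using dpow_eventually_0[OF D] by blast
  have "exp_der (\<lambda>p. F * D p) p = Sum_any (\<lambda>k. dpow D k p * F ^ k)"
    unfolding exp_der_def funpow_ker_mult[OF lnd_derivation[OF D] F] dpow_def by (simp add: ac_simps)
  also have "\<dots> = (\<Sum>k<N. dpow D k p * F ^ k)"
    by (rule Sum_any.expand_superset) (use N in \<open>auto simp: not_le[symmetric]\<close>)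
  finally show ?thesis
    by (simp add: poly_taylor[OF D N])
qed

definition expa ::
  "(('n, 'k::field_char_0) mpol \<Rightarrow> ('n, 'k) mpol) \<Rightarrow> ('n, 'k) mpol \<Rightarrow> ('n, 'k) pendo"
  where "expa D F = exp_aut (\<lambda>p. F * D p)"

lemma expa_apply: "lnd D \<Longrightarrow> D F = 0 \<Longrightarrow> expa D F i = poly (taylor D (X i)) F"
  by (simp add: expa_def exp_aut_def exp_der_eq_poly)

text \<open>In \<open>p\<close>, both sides are ring homomorphisms that fix constants and agree on
  the variables.\<close>

lemma psubst_expa:
  assumes "lnd D" "D F = 0"
  shows "psubst (expa D F) p = poly (taylor D p) F"
  by (induction p rule: mpol_induct)
    (simp_all add: assms expa_apply taylor_add taylor_mult taylor_Cst psubst_add psubst_mult)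

lemma commute_funpow:
  assumes "\<And>p. E (D p) = D (E p)"
  shows "E ((D ^^ k) p) = (D ^^ k) (E p)"
  by (induction k) (simp_all add: assms)

lemma psubst_poly_taylor:
  assumes D: "lnd D" and comm: "\<And>p. psubst g (D p) = D (psubst g p)"
  shows "psubst g (poly (taylor D p) F) = poly (taylor D (psubst g p)) (psubst g F)"
proof -
  have d: "psubst g (dpow D k p) = dpow D k (psubst g p)" for k
    by (simp add: dpow_def psubst_mult commute_funpow[of "psubst g" D, OF comm])
  obtain N where N: "\<And>k. k \<ge> N \<Longrightarrow> dpow D k p = 0"
    using dpow_eventually_0[OF D] by blast
  then have N': "\<And>k. k \<ge> N \<Longrightarrow> dpow D k (psubst g p) = 0"
    by (metis d psubst_0)
  have pow: "psubst g (F ^ k) = psubst g F ^ k" for k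
    by (induction k) (simp_all add: psubst_mult)
  show ?thesis
    by (simp add: poly_taylor[OF D N] poly_taylor[OF D N'] psubst_sum psubst_mult pow d)
qed

text \<open>A derivation commuting with \<open>D\<close> and killing \<open>F\<close> commutes with
  \<open>exp(F D)\<close>, as it passes through every summand of the series.\<close>

lemma derivation_poly_taylor:
  assumes D: "lnd D" and E: "derivation E" and comm: "\<And>p. E (D p) = D (E p)" and F: "E F = 0"
  shows "E (poly (taylor D p) F) = poly (taylor D (E p)) F"
proof -
  have d: "E (dpow D k p) = dpow D k (E p)" for k
    by (simp add: dpow_def derivation_scale[OF E] commute_funpow[of E D, OF comm])
  obtain N where N: "\<And>k. k \<ge> N \<Longrightarrow> dpow D k p = 0"
    using dpow_eventually_0[OF D] by blast
  then have N': "\<And>k. k \<ge> N \<Longrightarrow> dpow D k (E p) = 0"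
    by (metis d derivation_0[OF E])
  show ?thesis
    by (simp add: poly_taylor[OF D N] poly_taylor[OF D N'] derivation_sum[OF E] derivation_mult[OF E]
        derivation_power_ker[OF E F] d)
qed

lemma funpow_poly_taylor:
  assumes D: "lnd D" and "D F = 0"
  shows "(D ^^ k) (poly (taylor D p) F) = poly (taylor D ((D ^^ k) p)) F"
  by (induction k) (simp_all add: derivation_poly_taylor[OF D lnd_derivation[OF D] _ assms(2)])

lemma sum_square_triangle:
  fixes g :: "nat \<Rightarrow> nat \<Rightarrow> 'a::comm_monoid_add"
  assumes "\<And>j k. j + k \<ge> N \<Longrightarrow> g j k = 0"
  shows "(\<Sum>k<N. \<Sum>j<N. g j k) = (\<Sum>m<N. \<Sum>k\<le>m. g (m - k) k)"
proof -
  have "(\<Sum>k<N. \<Sum>j<N. g j k) = (\<Sum>(k, j)\<in>{..<N} \<times> {..<N}. g j k)"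
    by (simp add: sum.cartesian_product)
  also have "\<dots> = (\<Sum>(k, j)\<in>{(k, j). k + j < N}. g j k)"
    by (rule sum.mono_neutral_right) (auto intro!: assms simp: add.commute not_less)
  also have "\<dots> = (\<Sum>m<N. \<Sum>k\<le>m. g (m - k) k)"
    by (rule sum.triangle_reindex)
  finally show ?thesis .
qed

text \<open>This is \<open>exp(F D) exp(G D) = exp((F + G) D)\<close>: the double sum is grouped by
  total order \<open>m = j + k\<close>, and each group is a binomial expansion of
  \<open>(F + G) ^ m\<close>.\<close>

lemma poly_taylor_add:
  assumes D: "lnd D" and F: "D F = 0" and G: "D G = 0"
  shows "poly (taylor D (poly (taylor D p) G)) F = poly (taylor D p) (F + G)"
proof -
  note der = lnd_derivation[OF D]
  obtain N where N: "\<And>k. k \<ge> N \<Longrightarrow> dpow D k p = 0"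
    using dpow_eventually_0[OF D] by blast
  have N2: "dpow D j (dpow D k p) = 0" if "j + k \<ge> N" for j k
    using that by (simp add: dpow_dpow[OF der] N)
  have scale: "Cst c * poly (taylor D q) G = poly (taylor D (Cst c * q)) G" for c q
    by (simp add: taylor_mult[OF D] taylor_Cst[OF D])
  \<comment> \<open>As \<open>D G = 0\<close>, powers of \<open>D\<close> pass inside the inner
    exponential.\<close>
  have dt: "dpow D k (poly (taylor D p) G) = poly (taylor D (dpow D k p)) G" for k
    by (simp add: dpow_def funpow_poly_taylor[OF D G] scale)
  have dt2: "dpow D k (poly (taylor D p) G) = (\<Sum>j<N. dpow D j (dpow D k p) * G ^ j)" for k
    unfolding dt by (rule poly_taylor[OF D]) (simp add: N2)
  have 0: "dpow D k (poly (taylor D p) G) = 0" if "k \<ge> N" for k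
    using that by (simp add: dt2 N2)
  have "poly (taylor D (poly (taylor D p) G)) F = (\<Sum>k<N. \<Sum>j<N. dpow D j (dpow D k p) * G ^ j * F ^ k)"
    by (simp add: poly_taylor[OF D 0] dt2 sum_distrib_right)
  also have "\<dots> = (\<Sum>m<N. \<Sum>k\<le>m. dpow D (m - k) (dpow D k p) * G ^ (m - k) * F ^ k)"
    by (rule sum_square_triangle) (simp add: N2)
  also have "\<dots> = (\<Sum>m<N. dpow D m p * (F + G) ^ m)"
  proof (rule sum.cong[OF refl])
    fix m
    show "(\<Sum>k\<le>m. dpow D (m - k) (dpow D k p) * G ^ (m - k) * F ^ k) = dpow D m p * (F + G) ^ m"
      unfolding binomial_ring sum_distrib_left
      by (rule sum.cong[OF refl]) (simp add: dpow_dpow[OF der] algebra_simps)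
  qed
  finally show ?thesis
    by (simp add: poly_taylor[OF D N])
qed

lemma pcomp_expa:
  assumes "lnd D" "D F = 0" "D G = 0"
  shows "pcomp (expa D F) (expa D G) = expa D (F + G)"
proof
  fix i
  have "D (F + G) = 0"
    using assms by (simp add: derivation_add[OF lnd_derivation[OF assms(1)]])
  then show "pcomp (expa D F) (expa D G) i = expa D (F + G) i"
    using assms by (simp add: pcomp_def expa_apply psubst_expa poly_taylor_add add.commute)
qed

lemma expa_0: "lnd D \<Longrightarrow> expa D 0 = X"
  using expa_apply[of D 0] by (intro ext) (simp add: lnd_derivation derivation_0[of D] poly_0_coeff_0 coeff_taylor)

lemma poly_taylor_square_zero:
  assumes "lnd D" "D (D p) = 0"
  shows "poly (taylor D p) F = p + D p * F"
proof -
  have "(D ^^ 2) p = 0" using assms by (simp add: numeral_2_eq_2)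
  then have "dpow D k p = 0" if "k \<ge> 2" for k
    using funpow_eq_0_mono[OF lnd_derivation[OF assms(1)]] that by (simp add: dpow_def)
  from poly_taylor[OF assms(1) this] show ?thesis
    by (simp add: numeral_2_eq_2 dpow_def)
qed

text \<open>In \<open>D (p * q) = D p * q + p * D q\<close>, each summand has a smaller sum
  \<open>a + b\<close> of nilpotency bounds than \<open>p * q\<close>.\<close>

lemma nilpotent_mult:
  assumes D: "derivation D"
  shows "(D ^^ a) p = 0 \<Longrightarrow> (D ^^ b) q = 0 \<Longrightarrow> \<exists>n. (D ^^ n) (p * q) = 0"
proof (induction "a + b" arbitrary: a b p q)
  case 0
  then show ?case by (intro exI[of _ 0]) simp
next
  case (Suc s)
  show ?case
  proof (cases "a = 0 \<or> b = 0")
    case True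
    with Suc show ?thesis by (intro exI[of _ 0]) auto
  next
    case False
    then obtain a' b' where ab: "a = Suc a'" "b = Suc b'"
      by (meson not0_implies_Suc)
    from Suc.prems ab have "(D ^^ a') (D p) = 0" "(D ^^ b') (D q) = 0"
      by (simp_all add: funpow_swap1)
    with Suc.hyps(1)[of a' b "D p" q] Suc.hyps(1)[of a b' p "D q"] Suc.hyps(2) Suc.prems ab
    obtain m n where "(D ^^ m) (D p * q) = 0" "(D ^^ n) (p * D q) = 0"
      by auto
    then have "(D ^^ (m + n)) (D p * q) = 0" "(D ^^ (m + n)) (p * D q) = 0"
      using funpow_eq_0_mono[OF D] by (meson le_add1 le_add2)+
    then have "(D ^^ Suc (m + n)) (p * q) = 0"
      by (simp add: funpow_Suc_right derivation_mult[OF D] funpow_add_arg[OF D] del: funpow.simps)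
    then show ?thesis ..
  qed
qed

text \<open>The polynomials killed by some power of \<open>D\<close> form a subalgebra, so only the
  variables need checking.\<close>

lemma nilpotent_polys_in:
  fixes p :: "('n::finite, 'k::field) mpol"
  assumes D: "derivation D" and S: "\<And>i. i \<in> S \<Longrightarrow> \<exists>n. (D ^^ n) (X i) = 0" and "p \<in> polys_in S"
  shows "\<exists>n. (D ^^ n) p = 0"
  using assms(3)
proof (induction p rule: polys_in_induct)
  case (Cst c)
  show ?case using derivation_Cst[OF D] by (intro exI[of _ 1]) simp
next
  case (X i)
  then show ?case by (rule S)
next
  case (add p q)
  then obtain m n where "(D ^^ m) p = 0" "(D ^^ n) q = 0" by auto
  then have "(D ^^ (m + n)) p = 0" "(D ^^ (m + n)) q = 0"
    using funpow_eq_0_mono[OF D] by (meson le_add1 le_add2)+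
  then show ?case using funpow_add_arg[OF D] by (intro exI[of _ "m + n"]) simp
next
  case (mult p q)
  then show ?case using nilpotent_mult[OF D] by blast
qed

text \<open>Induction along the variable order: \<open>D (X i)\<close> involves only variables below
  \<open>i\<close>, each already killed by a power of \<open>D\<close>.\<close>

lemma lnd_triangular:
  assumes "triangular_derivation D"
  shows "lnd D"
proof -
  have D: "derivation D" and tri: "D (X i) \<in> polys_in {..<i}" for i
    using assms by (auto simp: triangular_derivation_def)
  have *: "\<exists>n. (D ^^ n) (X i) = 0" for i
  proof (induction i rule: measure_induct_rule[where f = "\<lambda>i. card {..<i}"])
    case (less i)
    have "\<exists>n. (D ^^ n) (D (X i)) = 0"
    proof (rule nilpotent_polys_in[OF D _ tri])
      fix j assume "j \<in> {..<i}"
      then have "{..<j} \<subset> {..<i}" by auto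
      then show "\<exists>n. (D ^^ n) (X j) = 0"
        by (intro less psubset_card_mono) auto
    qed
    then obtain n where "(D ^^ Suc n) (X i) = 0"
      by (auto simp: funpow_swap1)
    then show ?case by blast
  qed
  show ?thesis
    unfolding lnd_def using D * nilpotent_polys_in[OF D, of UNIV] by (auto simp: polys_in_def)
qed

lemma lnd_pdiff: "lnd (pdiff (i :: 'n::finite) :: ('n, 'k::field) mpol \<Rightarrow> _)"
proof -
  have "\<exists>n. (pdiff i ^^ n) (X j :: ('n, 'k) mpol) = 0" for j
    using derivation_1[OF derivation_pdiff[of i]] by (intro exI[of _ 2]) (auto simp: numeral_2_eq_2 pdiff_X)
  then have "\<exists>n. (pdiff i ^^ n) p = 0" for p :: "('n, 'k) mpol"
    by (rule nilpotent_polys_in[OF derivation_pdiff, of UNIV]) (auto simp: polys_in_def)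
  then show ?thesis
    by (simp add: lnd_def derivation_pdiff)
qed

section \<open>Jacobian determinants and commutators\<close>

text \<open>Polynomial dependence on a scalar \<open>t\<close>, with coefficients in the polynomial
  ring itself. The values at the infinitely many constants \<open>Cst t\<close> determine the
  polynomial when that ring is a domain.\<close>

definition poly_family :: "('k::field_char_0 \<Rightarrow> ('n, 'k) mpol) \<Rightarrow> bool"
  where "poly_family f \<longleftrightarrow> (\<exists>P. \<forall>t. f t = poly P (Cst t))"

lemma poly_family_const: "poly_family (\<lambda>t. c)"
  unfolding poly_family_def by (rule exI[of _ "[:c:]"]) simp

lemma poly_family_Cst: "poly_family Cst"
  unfolding poly_family_def by (rule exI[of _ "[:0, 1:]"]) simp

lemma poly_family_add: "poly_family f \<Longrightarrow> poly_family g \<Longrightarrow> poly_family (\<lambda>t. f t + g t)"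
  unfolding poly_family_def by (metis poly_add)

lemma poly_family_mult: "poly_family f \<Longrightarrow> poly_family g \<Longrightarrow> poly_family (\<lambda>t. f t * g t)"
  unfolding poly_family_def by (metis poly_mult)

lemma poly_family_sum: "(\<And>a. a \<in> A \<Longrightarrow> poly_family (f a)) \<Longrightarrow> poly_family (\<lambda>t. \<Sum>a\<in>A. f a t)"
  by (induction A rule: infinite_finite_induct) (simp_all add: poly_family_const poly_family_add)

lemma poly_family_prod: "(\<And>a. a \<in> A \<Longrightarrow> poly_family (f a)) \<Longrightarrow> poly_family (\<lambda>t. \<Prod>a\<in>A. f a t)"
  by (induction A rule: infinite_finite_induct) (simp_all add: poly_family_const poly_family_mult)

lemma poly_family_poly: "poly_family (\<lambda>t. poly Q (Cst t * F))"
  by (induction Q) (simp_all add: poly_family_const poly_family_add poly_family_mult poly_family_Cst)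

text \<open>Horner's scheme: the operator \<open>L t\<close> itself varies with \<open>t\<close>,
  and linearity moves it past each factor \<open>Cst t\<close> onto the fixed coefficients.\<close>

lemma poly_family_linear:
  assumes L: "\<And>t p q. L t (p + Cst t * q) = L t p + Cst t * L t q" and c: "\<And>c. poly_family (\<lambda>t. L t c)"
    and f: "poly_family f"
  shows "poly_family (\<lambda>t. L t (f t))"
proof -
  obtain P where P: "f = (\<lambda>t. poly P (Cst t))"
    using f by (auto simp: poly_family_def)
  have "poly_family (\<lambda>t. L t (poly P (Cst t)))"
    by (induction P) (simp_all add: L c poly_family_add poly_family_mult poly_family_Cst)
  then show ?thesis by (simp add: P)
qed

lemma poly_family_pdiff: "poly_family f \<Longrightarrow> poly_family (\<lambda>t. pdiff j (f t))"
  by (rule poly_family_linear) (simp_all add: pdiff_add pdiff_mult poly_family_const)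

lemma lnd_Cst_mult_ker: "lnd D \<Longrightarrow> D F = 0 \<Longrightarrow> D (Cst t * F) = 0"
  using derivation_scale[OF lnd_derivation, of D t F] by simp

lemma poly_family_psubst_expa:
  assumes "lnd D" "D F = 0" "poly_family f"
  shows "poly_family (\<lambda>t. psubst (expa D (Cst t * F)) (f t))"
  using assms(3)
proof (rule poly_family_linear[rotated 2])
  show "poly_family (\<lambda>t. psubst (expa D (Cst t * F)) c)" for c
    using assms(1,2) by (simp add: psubst_expa lnd_Cst_mult_ker[OF assms(1,2)] poly_family_poly)
qed (simp add: psubst_add psubst_mult)

lemma poly_family_jacobian_expa:
  assumes "lnd D" "D F = 0"
  shows "poly_family (\<lambda>t. jacobian_det (expa D (Cst t * F)))"
  unfolding jacobian_det_def det_def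
  by (auto intro!: poly_family_sum poly_family_mult poly_family_prod poly_family_pdiff poly_family_const poly_family_poly
      simp: expa_apply[OF assms(1) lnd_Cst_mult_ker[OF assms]])

text \<open>\<open>P * Q - 1\<close> has all \<open>Cst t\<close> as roots, hence is zero; over a
  domain both factors of \<open>1\<close> then have degree zero.\<close>

lemma poly_family_unit_const:
  fixes f g :: "'k::field_char_0 \<Rightarrow> ('n::linorder, 'k) mpol"
  assumes "poly_family f" "poly_family g" "\<And>t. f t * g t = 1"
  shows "g s = g t"
proof -
  obtain P Q where P: "f = (\<lambda>t. poly P (Cst t))" and Q: "g = (\<lambda>t. poly Q (Cst t))"
    using assms(1,2) unfolding poly_family_def fun_eq_iff by blast
  have "inj (Cst :: 'k \<Rightarrow> ('n, 'k) mpol)" by (rule injI) simp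
  then have "infinite (range (Cst :: 'k \<Rightarrow> ('n, 'k) mpol))"
    by (simp add: finite_image_iff infinite_UNIV_char_0)
  moreover have "range Cst \<subseteq> {x. poly (P * Q - 1) x = 0}"
    using assms(3) by (auto simp: P Q)
  ultimately have "P * Q - 1 = 0"
    using poly_roots_finite finite_subset by metis
  then have PQ: "P * Q = 1" by simp
  then have "degree P + degree Q = 0"
    by (metis degree_1 degree_mult_eq mult_zero_left mult_zero_right zero_neq_one)
  then have "degree Q = 0" by simp
  then show ?thesis
    by (auto elim!: degree_eq_zeroE simp: Q)
qed

text \<open>The Jacobian determinant of \<open>exp(t F D)\<close> is a polynomial in \<open>t\<close> dividing \<open>1\<close> by the chain
  rule, hence constant in \<open>t\<close>.\<close>

lemma jacobian_det_expa:
  fixes D :: "('n::{finite,linorder}, 'k::field_char_0) mpol \<Rightarrow> ('n, 'k) mpol"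
  assumes D: "lnd D" and F: "D F = 0"
  shows "jacobian_det (expa D F) = 1"
proof -
  let ?G = "- F"
  have G: "D ?G = 0" using derivation_minus[OF lnd_derivation[OF D], of F] F by simp
  have "psubst (expa D (Cst t * F)) (jacobian_det (expa D (Cst t * ?G))) * jacobian_det (expa D (Cst t * F)) = 1" for t
    unfolding jacobian_det_pcomp[symmetric]
    by (subst pcomp_expa[OF D lnd_Cst_mult_ker[OF D G] lnd_Cst_mult_ker[OF D F]]) (simp add: expa_0[OF D, simplified])
  \<comment> \<open>The value at \<open>t = 1\<close> is compared with the one at
    \<open>t = 0\<close>, where the exponential is the identity.\<close>
  then have "jacobian_det (expa D (Cst 1 * F)) = jacobian_det (expa D (Cst 0 * F))"
    by (rule poly_family_unit_const[rotated 2])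
      (intro poly_family_psubst_expa poly_family_jacobian_expa D F G)+
  then show ?thesis using expa_0[OF D] by simp
qed

lemma expa_inverse:
  assumes D: "lnd D" and F: "D F = 0"
  shows "pcomp (expa D F) (expa D (- F)) = X" "pcomp (expa D (- F)) (expa D F) = X"
proof -
  have G: "D (- F) = 0" using derivation_minus[OF lnd_derivation[OF D], of F] F by simp
  show "pcomp (expa D F) (expa D (- F)) = X" "pcomp (expa D (- F)) (expa D F) = X"
    using pcomp_expa[OF D F G] pcomp_expa[OF D G F] expa_0[OF D] by simp_all
qed

section \<open>Conjugation and commutators in normal subgroups of \<open>SA\<close>\<close>

lemma SA_simps [simp]: "monoid.mult SA = pcomp" "one SA = X"
  by (simp_all add: SA_def GA_def)

lemma carrier_SA: "f \<in> carrier SA \<longleftrightarrow> (\<exists>g. pcomp f g = X \<and> pcomp g f = X) \<and> jacobian_det f = 1"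
  by (simp add: SA_def GA_def)

lemma expa_in_SA:
  fixes D :: "('n::{finite,linorder}, 'k::field_char_0) mpol \<Rightarrow> ('n, 'k) mpol"
  assumes "lnd D" "D F = 0"
  shows "expa D F \<in> carrier SA"
  unfolding carrier_SA using expa_inverse[OF assms] jacobian_det_expa[OF assms] by blast

lemma normal_SA_pcomp: "N \<lhd> SA \<Longrightarrow> f \<in> N \<Longrightarrow> g \<in> N \<Longrightarrow> pcomp f g \<in> N"
  using subgroup.m_closed[OF normal_imp_subgroup, of N SA f g] by simp

lemma normal_SA_inverse:
  fixes N :: "('n::finite, 'k::field) pendo set" and f g :: "('n, 'k) pendo"
  assumes N: "N \<lhd> SA" and f: "f \<in> carrier SA" and g: "g \<in> carrier SA" and "pcomp f g = X"
  shows "inv\<^bsub>SA\<^esub> g = f"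
  using group.inv_equality[of SA f g] normal.axioms(2)[OF N] assms by simp

lemma normal_SA_inv_closed:
  assumes N: "N \<lhd> SA" and f: "f \<in> carrier SA" and g: "g \<in> N" and "pcomp f g = X"
  shows "f \<in> N"
  using normal_SA_inverse[OF N f _ assms(4)] subgroup.m_inv_closed[OF normal_imp_subgroup[OF N] g]
    subgroup.mem_carrier[OF normal_imp_subgroup[OF N] g] by simp

lemma normal_SA_conj:
  assumes N: "N \<lhd> SA" and f: "f \<in> carrier SA" and g: "g \<in> carrier SA" and fg: "pcomp f g = X" and h: "h \<in> N"
  shows "pcomp (pcomp f h) g \<in> N"
  using normal.inv_op_closed1[OF N g h] normal_SA_inverse[OF N f g fg] by simp

text \<open>The ring map \<open>psubst \<phi>\<close> commutes with \<open>D\<close>, so it carries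
  the exponential series with parameter \<open>F\<close> to the one with parameter
  \<open>psubst \<phi> F\<close>.\<close>

lemma conj_expa:
  assumes D: "lnd D" and F: "D F = 0" and comm: "\<And>p. psubst \<phi> (D p) = D (psubst \<phi> p)"
    and inv: "pcomp \<psi> \<phi> = X"
  shows "pcomp (pcomp \<psi> (expa D F)) \<phi> = expa D (psubst \<phi> F)"
proof
  fix i
  have "D (psubst \<phi> F) = 0" using comm[of F] F by simp
  then have "pcomp (pcomp \<psi> (expa D F)) \<phi> i = poly (taylor D (psubst \<phi> (\<psi> i))) (psubst \<phi> F)"
    by (simp add: pcomp_def psubst_expa[OF D F] psubst_poly_taylor[OF D comm])
  also have "psubst \<phi> (\<psi> i) = X i"
    using inv by (metis pcomp_def)
  finally show "pcomp (pcomp \<psi> (expa D F)) \<phi> i = expa D (psubst \<phi> F) i"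
    using \<open>D (psubst \<phi> F) = 0\<close> by (simp add: expa_apply[OF D])
qed

text \<open>The commutator is read in two ways: as a conjugate of \<open>exp(F D)\<close> times
  \<open>exp(- F D)\<close>, or as \<open>\<psi>\<close> times a conjugate of \<open>\<phi>\<close>.
  Either reading puts it in \<open>N\<close> if the respective factor is there.\<close>

lemma commutator_expa:
  fixes D :: "('n::{finite,linorder}, 'k::field_char_0) mpol \<Rightarrow> ('n, 'k) mpol"
  assumes N: "N \<lhd> SA" and D: "lnd D" and F: "D F = 0" and comm: "\<And>p. psubst \<phi> (D p) = D (psubst \<phi> p)"
    and \<phi>: "\<phi> \<in> carrier SA" and \<psi>: "\<psi> \<in> carrier SA" and inv: "pcomp \<psi> \<phi> = X"
    and mem: "expa D F \<in> N \<or> \<phi> \<in> N"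
  shows "expa D (psubst \<phi> F - F) \<in> N"
proof -
  have G: "D (- F) = 0" using derivation_minus[OF lnd_derivation[OF D], of F] F by simp
  note E = expa_in_SA[OF D F] expa_in_SA[OF D G]
  have "D (psubst \<phi> F) = 0" using comm[of F] F by simp
  then have eq: "expa D (psubst \<phi> F - F) = pcomp (pcomp (pcomp \<psi> (expa D F)) \<phi>) (expa D (- F))"
    using conj_expa[OF D F comm inv] pcomp_expa[OF D _ G, of "psubst \<phi> F"] by simp
  from mem show ?thesis
  proof
    assume m: "expa D F \<in> N"
    have "expa D (- F) \<in> N"
      by (rule normal_SA_inv_closed[OF N E(2) m]) (rule expa_inverse[OF D F])
    with normal_SA_conj[OF N \<psi> \<phi> inv m] show ?thesis
      unfolding eq by (rule normal_SA_pcomp[OF N])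
  next
    assume m: "\<phi> \<in> N"
    have "\<psi> \<in> N" by (rule normal_SA_inv_closed[OF N \<psi> m inv])
    moreover have "pcomp (pcomp (expa D F) \<phi>) (expa D (- F)) \<in> N"
      by (rule normal_SA_conj[OF N E(1) E(2) _ m]) (rule expa_inverse[OF D F])
    ultimately show ?thesis
      unfolding eq pcomp_assoc by (rule normal_SA_pcomp[OF N])
  qed
qed

section \<open>The special linear group\<close>

definition row_add :: "'n::finite \<Rightarrow> 'n \<Rightarrow> 'k::field \<Rightarrow> 'k^'n^'n \<Rightarrow> 'k^'n^'n"
  where "row_add i j c A = (\<chi> k. if k = i then row i A + c *s row j A else row k A)"

lemma row_add_nth: "row_add i j c A $ r $ s = A $ r $ s + (if r = i then c * A $ j $ s else 0)"
  by (simp add: row_add_def row_def)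

lemma det_row_add: "i \<noteq> j \<Longrightarrow> det (row_add i j c A) = det A"
  unfolding row_add_def by (rule det_row_operation)

lemma row_add_inverse: "i \<noteq> j \<Longrightarrow> row_add i j (- c) (row_add i j c A) = A"
  by (simp add: vec_eq_iff row_add_nth)

text \<open>The invariant of the column-by-column elimination in
  \<open>SL_row_induct\<close>.\<close>

definition unit_cols :: "'n set \<Rightarrow> 'k::field^'n^'n \<Rightarrow> bool"
  where "unit_cols S A \<longleftrightarrow> (\<forall>c\<in>S. \<forall>r. A $ r $ c = (if r = c then 1 else 0))"

lemma pivot_exists:
  fixes A :: "'k::field^'n^'n"
  assumes "unit_cols S A" "det A \<noteq> 0" "k \<notin> S"
  obtains r where "r \<notin> S" "A $ r $ k \<noteq> 0"
proof (rule ccontr)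
  assume "\<not> thesis"
  with that have 0: "A $ r $ k = 0" if "r \<notin> S" for r
    using \<open>r \<notin> S\<close> by blast
  \<comment> \<open>Column \<open>k\<close> would be a combination of the unit columns in
    \<open>S\<close>; \<open>?v\<close> records this relation and is a nonzero kernel
    vector.\<close>
  let ?v = "\<chi> c. if c = k then - 1 else if c \<in> S then A $ c $ k else 0"
  have "(\<Sum>c\<in>UNIV. A $ r $ c * ?v $ c) = 0" for r
  proof -
    have "(\<Sum>c\<in>UNIV. A $ r $ c * ?v $ c)
      = (\<Sum>c\<in>UNIV. (if c = k then - A $ r $ k else 0) + (if c = r then (if r \<in> S then A $ r $ k else 0) else 0))"
      using assms(1,3) by (intro sum.cong) (auto simp: unit_cols_def)
    also have "\<dots> = 0"
      using 0[of r] by (simp add: sum.distrib)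
    finally show ?thesis .
  qed
  then have "A *v ?v = 0"
    by (simp add: matrix_vector_mult_def vec_eq_iff)
  moreover have "invertible A"
    using assms(2) by (simp add: invertible_det_nz)
  ultimately have "?v = 0"
    unfolding invertible_def using matrix_left_invertible_ker by blast
  then have "?v $ k = 0" by simp
  then show False by simp
qed

text \<open>In other words, transvections generate \<open>SL\<^sub>n\<close>.\<close>

lemma SL_row_induct [consumes 1, case_names one row_add]:
  fixes A :: "'k::field^'n^'n"
  assumes det: "det A = 1" and one: "P (mat 1)"
    and step: "\<And>A i j c. i \<noteq> j \<Longrightarrow> P A \<Longrightarrow> P (row_add i j c A)"
  shows "P A"
proof -
  define Q where "Q B \<longleftrightarrow> (det B = 1 \<longrightarrow> P B)" for B
  \<comment> \<open>A row operation may be applied to the goal, since its inverse is again a row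
    operation of the kind allowed by \<open>step\<close>.\<close>
  have undo: "Q B" if "Q (row_add i j c B)" "i \<noteq> j" for B i j c
    using that step[of i j "row_add i j c B" "- c"] by (auto simp: Q_def det_row_add row_add_inverse)
  \<comment> \<open>Multiples of row \<open>k\<close> are added to all rows in \<open>T\<close> at
    once; row \<open>k\<close> itself stays fixed because \<open>k\<close> is not in
    \<open>T\<close>.\<close>
  have clear: "k \<notin> T \<Longrightarrow> Q (\<chi> r s. B $ r $ s + (if r \<in> T then d r * B $ k $ s else 0)) \<Longrightarrow> Q B" for B T d k
    using finite[of T]
  proof (induction T arbitrary: B rule: finite_induct)
    case empty
    then show ?case by simp
  next
    case (insert x T)
    let ?C = "row_add x k (d x) B"
    have eq: "(\<chi> r s. ?C $ r $ s + (if r \<in> T then d r * ?C $ k $ s else 0)) =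
      (\<chi> r s. B $ r $ s + (if r \<in> insert x T then d r * B $ k $ s else 0))"
      using insert.hyps insert.prems(1) by (simp add: vec_eq_iff row_add_nth)
    have "Q ?C"
    proof (rule insert.IH)
      show "Q (\<chi> r s. ?C $ r $ s + (if r \<in> T then d r * ?C $ k $ s else 0))"
        unfolding eq by (rule insert.prems(2))
    qed (use insert.prems(1) in simp)
    then show ?case by (rule undo) (use insert.prems(1) in auto)
  qed
  have main: "Q B" if "unit_cols S B" for S B
    using that
  proof (induction "card (- S)" arbitrary: S B rule: less_induct)
    case less
    show ?case
    proof (cases "S = UNIV")
      case True
      with less have "B = mat 1"
        by (auto simp: unit_cols_def vec_eq_iff mat_def)
      then show ?thesis by (simp add: Q_def one)
    next
      case False
      then obtain k where k: "k \<notin> S" by blast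
      \<comment> \<open>\<open>C B\<close> clears column \<open>k\<close> off the diagonal. The
        columns in \<open>S\<close> survive since row \<open>k\<close> is zero there.\<close>
      define C where "C B = (\<chi> r s. B $ r $ s + (if r \<in> - {k} then (- (B $ r $ k / B $ k $ k)) * B $ k $ s else 0))"
        for B :: "'k^'n^'n"
      have QC: "Q B" if "Q (C B)" for B
        using that unfolding C_def by (rule clear[rotated]) simp
      have ucC: "unit_cols S (C B)" if "unit_cols S B" for B
        using that k by (auto simp: unit_cols_def C_def)
      have Ck: "C B $ r $ k = (if r = k then B $ k $ k else 0)" if "B $ k $ k \<noteq> 0" for B r
        using that by (simp add: C_def)
      have IH: "Q B" if "unit_cols (insert k S) B" for B
      proof (rule less.hyps[OF _ that])
        have "- insert k S \<subset> - S" using k by auto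
        then show "card (- insert k S) < card (- S)" by (intro psubset_card_mono) auto
      qed
      have claim1: "Q B" if "unit_cols S B" "B $ k $ k = 1" for B
        by (rule QC, rule IH) (use that ucC[OF that(1)] Ck[of B] in \<open>auto simp: unit_cols_def\<close>)
      \<comment> \<open>The multiple of row \<open>r\<close> is chosen to turn the pivot into
        \<open>1\<close>; row \<open>r\<close> has zeros in the columns of \<open>S\<close>, so
        these are not disturbed.\<close>
      have claim2: "Q B" if "unit_cols S B" "r \<notin> S" "r \<noteq> k" "B $ r $ k \<noteq> 0" for B r
      proof (rule undo[of k r "(1 - B $ k $ k) / B $ r $ k"])
        show "Q (row_add k r ((1 - B $ k $ k) / B $ r $ k) B)"
          using that k by (intro claim1) (auto simp: unit_cols_def row_add_nth)
      qed (use that in auto)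
      \<comment> \<open>What remains is a nonzero pivot on the diagonal. A further row outside
        \<open>S\<close>, if there is one, receives row \<open>k\<close> when its entry is zero,
        which leads back to \<open>claim2\<close>.\<close>
      have "Q B" if uc: "unit_cols S B" and d: "det B = 1" and "B $ k $ k \<noteq> 0" for B
      proof (cases "\<exists>l. l \<notin> S \<and> l \<noteq> k")
        case True
        then obtain l where l: "l \<notin> S" "l \<noteq> k" by blast
        show ?thesis
        proof (cases "B $ l $ k = 0")
          case True
          show ?thesis
          proof (rule undo[of l k 1])
            show "Q (row_add l k 1 B)"
              using that l k True by (intro claim2[of _ l]) (auto simp: unit_cols_def row_add_nth)
          qed (rule l)
        qed (use claim2 l uc in blast)
      next
        case False
        then have S: "S = - {k}" using k by auto
        have diag: "C B $ r $ s = (if r = s then if r = k then B $ k $ k else 1 else 0)" for r s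
          using ucC[OF uc] Ck[OF that(3)] by (cases "s = k") (auto simp: S unit_cols_def)
        have "det (C B) = (\<Prod>i\<in>UNIV. if i = k then B $ k $ k else 1)"
          by (subst det_diagonal) (simp_all add: diag)
        then have "det (C B) = B $ k $ k"
          by simp
        \<comment> \<open>In the last column \<open>C B\<close> is diagonal with determinant equal
          to the pivot, so \<open>Q (C B)\<close> is vacuous unless the pivot is
          \<open>1\<close>.\<close>
        then have "Q (C B)"
          using IH[of "C B"] by (cases "B $ k $ k = 1") (auto simp: Q_def unit_cols_def diag)
        then show ?thesis by (rule QC)
      qed
      with claim2 show ?thesis
        using less.prems k pivot_exists[OF less.prems _ k] unfolding Q_def by (metis one_neq_zero)
    qed
  qed
  from main[of "{}" A] det show ?thesis by (simp add: Q_def unit_cols_def)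
qed

section \<open>Transvections as exponentials, and polynomials with zero gradient\<close>

lemma linear_endo_mat_1: "linear_endo (mat 1) = X"
proof
  fix i :: 'a
  have "(\<Sum>j\<in>UNIV. Cst (mat 1 $ i $ j) * X j) = (\<Sum>j\<in>UNIV. if j = i then X j else (0 :: ('a, 'b) mpol))"
    by (rule sum.cong) (auto simp: mat_def)
  then show "linear_endo (mat 1 :: 'b^'a^'a) i = X i"
    by (simp add: linear_endo_def)
qed

lemma pdiff_commute: "pdiff i (pdiff j p) = pdiff j (pdiff i (p :: ('n::finite, 'k::field) mpol))"
  by (rule derivations_commute) (simp_all add: derivation_pdiff pdiff_X derivation_0[OF derivation_pdiff] derivation_1[OF derivation_pdiff])

lemma pdiff_1 [simp]: "pdiff i 1 = 0"
  using pdiff_Cst[of i 1] by simp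

lemma expa_pdiff_apply:
  fixes G :: "('n::finite, 'k::field_char_0) mpol"
  assumes "pdiff i G = 0"
  shows "expa (pdiff i) G k = (if k = i then X i + G else X k)"
  unfolding expa_apply[of "pdiff i", OF lnd_pdiff assms]
  by (subst poly_taylor_square_zero[OF lnd_pdiff]) (simp_all add: pdiff_X)

text \<open>The exponential on the right is the transvection
  \<open>X i \<mapsto> X i + c X j\<close>; composing with it on the left is a row operation on the
  matrix.\<close>

lemma linear_endo_row_add:
  fixes A :: "'k::field_char_0^'n^'n"
  assumes "i \<noteq> j"
  shows "linear_endo (row_add i j c A) = pcomp (expa (pdiff i) (Cst c * X j)) (linear_endo A)"
proof
  fix k
  have "pdiff i (Cst c * X j) = 0"
    using assms by (simp add: pdiff_mult pdiff_X)
  then show "linear_endo (row_add i j c A) k = pcomp (expa (pdiff i) (Cst c * X j)) (linear_endo A) k"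
    by (cases "k = i") (simp_all add: pcomp_def expa_pdiff_apply psubst_add psubst_mult linear_endo_def row_add_nth
        Cst_add Cst_mult algebra_simps sum.distrib sum_distrib_left)
qed

lemma lookup_pdiff:
  fixes p :: "('n, 'k::comm_ring_1) mpol"
  shows "Poly_Mapping.lookup (pdiff j p) k =
    of_nat (Suc (Poly_Mapping.lookup k j)) * Poly_Mapping.lookup p (k + Poly_Mapping.single j 1)"
proof -
  let ?m = "k + Poly_Mapping.single j 1"
  have "Poly_Mapping.lookup (pdiff j p) k
    = (\<Sum>m\<in>Poly_Mapping.keys p. if m = ?m then of_nat (Poly_Mapping.lookup m j) * Poly_Mapping.lookup p m else 0)"
    unfolding pdiff_def lookup_sum
  proof (rule sum.cong[OF refl])
    fix m
    \<comment> \<open>Truncated subtraction may also send an exponent without \<open>j\<close> to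
      \<open>k\<close>; such a term has coefficient \<open>0\<close>.\<close>
    have *: "m = ?m" if "m - Poly_Mapping.single j 1 = k" "Poly_Mapping.lookup m j \<noteq> 0"
      by (rule poly_mapping_eqI) (use that in \<open>auto simp: lookup_add lookup_minus lookup_single when_def\<close>)
    show "Poly_Mapping.lookup (Poly_Mapping.single (m - Poly_Mapping.single j 1)
        (of_nat (Poly_Mapping.lookup m j) * Poly_Mapping.lookup p m)) k =
      (if m = ?m then of_nat (Poly_Mapping.lookup m j) * Poly_Mapping.lookup p m else 0)"
    proof (cases "m = ?m")
      case True
      then have "m - Poly_Mapping.single j 1 = k" by simp
      with True show ?thesis by simp
    next
      case False
      with * have "m - Poly_Mapping.single j 1 \<noteq> k \<or> Poly_Mapping.lookup m j = 0" by blast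
      with False show ?thesis by (auto simp: lookup_single when_def)
    qed
  qed
  also have "\<dots> = of_nat (Poly_Mapping.lookup ?m j) * Poly_Mapping.lookup p ?m"
    by (auto simp: in_keys_iff)
  finally show ?thesis by (simp add: lookup_add)
qed

text \<open>A nonconstant monomial contains some variable \<open>j\<close>, and in characteristic
  zero its coefficient reappears in \<open>pdiff j p\<close> up to a nonzero integer factor.\<close>

lemma pdiff_all_0_imp_Cst:
  fixes p :: "('n, 'k::field_char_0) mpol"
  assumes "\<And>j. pdiff j p = 0"
  obtains c where "p = Cst c"
proof
  show "p = Cst (Poly_Mapping.lookup p 0)"
  proof (rule poly_mapping_eqI)
    fix m
    show "Poly_Mapping.lookup p m = Poly_Mapping.lookup (Cst (Poly_Mapping.lookup p 0)) m"
    proof (cases "m = 0")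
      case False
      then obtain j where j: "Poly_Mapping.lookup m j \<noteq> 0"
        by (metis lookup_zero poly_mapping_eqI)
      let ?k = "m - Poly_Mapping.single j 1"
      have "m = ?k + Poly_Mapping.single j 1"
        by (rule poly_mapping_eqI) (use j in \<open>auto simp: lookup_add lookup_minus lookup_single when_def\<close>)
      then have "of_nat (Suc (Poly_Mapping.lookup ?k j)) * Poly_Mapping.lookup p m = 0"
        using lookup_pdiff[of j p ?k] assms[of j] by simp
      then have "Poly_Mapping.lookup p m = 0"
        by (metis mult_eq_0_iff of_nat_neq_0)
      with False show ?thesis by (simp add: Cst_def lookup_single when_def)
    qed (simp add: Cst_def)
  qed
qed

section \<open>Normal subgroups containing an exponential\<close>

lemma taylor_0: "lnd D \<Longrightarrow> taylor D 0 = 0"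
  using taylor_Cst[of D 0] by simp

text \<open>\<open>exp E - 1\<close> lowers the nilpotency index with respect to \<open>E\<close> by exactly one.\<close>

lemma difference_descent:
  assumes E: "lnd E" and P: "P H" and nz: "H \<noteq> 0"
    and step: "\<And>H. P H \<Longrightarrow> P (poly (taylor E H) 1 - H)"
  obtains H' where "H' \<noteq> 0" "E H' = 0" "P H'"
proof -
  note der = lnd_derivation[OF E]
  obtain r where "(E ^^ r) H = 0"
    using E by (auto simp: lnd_def)
  then have "\<exists>H'. H' \<noteq> 0 \<and> E H' = 0 \<and> P H'"
    using P nz
  proof (induction r arbitrary: H)
    case 0
    then show ?case by simp
  next
    case (Suc r)
    show ?case
    proof (cases "E H = 0")
      case True
      with Suc show ?thesis by blast
    next
      case False
      \<comment> \<open>The nilpotency index of \<open>H\<close> is at least two, as neither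
        \<open>H\<close> nor \<open>E H\<close> vanishes, so it can be written
        \<open>Suc (Suc s)\<close>.\<close>
      then obtain s where s: "(E ^^ Suc s) H \<noteq> 0" "(E ^^ Suc (Suc s)) H = 0"
      proof -
        define t where "t = (LEAST t. (E ^^ t) H = 0)"
        have t: "(E ^^ t) H = 0" unfolding t_def using Suc.prems(1) by (rule LeastI)
        have lt: "(E ^^ u) H \<noteq> 0" if "u < t" for u using that not_less_Least unfolding t_def by blast
        have "t \<noteq> 0" "t \<noteq> 1"
          using t False Suc.prems(3) by (intro notI; simp)+
        then obtain s where "t = Suc (Suc s)"
          by (metis One_nat_def not0_implies_Suc)
        with t lt[of "Suc s"] show thesis by (intro that) auto
      qed
      have le: "Suc s \<le> r"
        using s(1) Suc.prems(1) funpow_eq_0_mono[OF der] by (metis not_less_eq_eq)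
      let ?H = "poly (taylor E H) 1 - H"
      have pow: "(E ^^ k) ?H = poly (taylor E ((E ^^ k) H)) 1 - (E ^^ k) H" for k
      proof -
        have "(E ^^ k) (poly (taylor E H) 1) = (E ^^ k) (?H + H)" by simp
        also have "\<dots> = (E ^^ k) ?H + (E ^^ k) H" by (rule funpow_add_arg[OF der])
        finally show ?thesis
          using funpow_poly_taylor[OF E derivation_1[OF der], of k H] by (simp add: eq_diff_eq)
      qed
      \<comment> \<open>On \<open>(E ^^ s) H\<close> the exponential series stops after its linear
        term, so the difference is one more application of \<open>E\<close>; in particular
        \<open>?H\<close> is nonzero.\<close>
      have "(E ^^ s) ?H = (E ^^ Suc s) H"
        using poly_taylor_square_zero[OF E, of "(E ^^ s) H" 1] s(2) by (simp add: pow)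
      then have nz: "?H \<noteq> 0"
        using s(1) funpow_derivation_0[OF der, of s] by auto
      have "(E ^^ Suc s) ?H = 0"
        unfolding pow using poly_taylor_square_zero[OF E, of "(E ^^ Suc s) H" 1] s(2) derivation_0[OF der] by simp
      then have "(E ^^ r) ?H = 0"
        by (rule funpow_eq_0_mono[OF der _ le])
      then show ?thesis
        using nz step[OF Suc.prems(2)] by (intro Suc.IH)
    qed
  qed
  with that show thesis by blast
qed

text \<open>\<open>exp(G E)\<close> commutes with \<open>D\<close> because \<open>D\<close> commutes
  with \<open>E\<close> and kills \<open>G\<close>. All commutators below are instances of
  this.\<close>

lemma commutator_expa_expa:
  fixes D :: "('n::{finite,linorder}, 'k::field_char_0) mpol \<Rightarrow> ('n, 'k) mpol"
  assumes N: "N \<lhd> SA" and D: "lnd D" and E: "lnd E" and comm: "\<And>p. D (E p) = E (D p)"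
    and F: "D F = 0" and G: "D G = 0" "E G = 0"
    and mem: "expa D F \<in> N \<or> expa E G \<in> N"
  shows "expa D (poly (taylor E F) G - F) \<in> N"
proof -
  have G': "E (- G) = 0" using derivation_minus[OF lnd_derivation[OF E], of G] G by simp
  have "expa D (psubst (expa E G) F - F) \<in> N"
  proof (rule commutator_expa[OF N D F _ expa_in_SA[OF E G(2)] expa_in_SA[OF E G'] _ mem])
    show "psubst (expa E G) (D p) = D (psubst (expa E G) p)" for p
      unfolding psubst_expa[OF E G(2)]
      by (rule derivation_poly_taylor[OF E lnd_derivation[OF D] comm G(1), symmetric])
    show "pcomp (expa E (- G)) (expa E G) = X"
      by (rule expa_inverse[OF E G(2)])
  qed
  then show ?thesis by (simp only: psubst_expa[OF E G(2)])
qed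

text \<open>The translation by \<open>c\<close> along \<open>k\<close> changes
  \<open>(b / c) X k\<close> by the constant \<open>b\<close>; its commutator with the matching
  transvection is therefore a translation along \<open>i\<close>.\<close>

lemma translations_in_normal:
  fixes N :: "('n::{finite,linorder}, 'k::field_char_0) pendo set"
  assumes N: "N \<lhd> SA" and c: "c \<noteq> 0" "expa (pdiff k) (Cst c) \<in> N" and "i \<noteq> k"
  shows "expa (pdiff i) (Cst b) \<in> N"
proof -
  have "expa (pdiff i) (poly (taylor (pdiff k) (Cst (b / c) * X k)) (Cst c) - Cst (b / c) * X k) \<in> N"
    using assms by (intro commutator_expa_expa lnd_pdiff pdiff_commute) (auto simp: pdiff_mult pdiff_X)
  moreover have "poly (taylor (pdiff k) (Cst (b / c) * X k)) (Cst c) - Cst (b / c) * X k = Cst b"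
    using c by (subst poly_taylor_square_zero[OF lnd_pdiff])
      (simp_all add: pdiff_mult pdiff_X flip: Cst_mult)
  ultimately show ?thesis by simp
qed

lemma transvections_in_normal:
  fixes N :: "('n::{finite,linorder}, 'k::field_char_0) pendo set"
  assumes N: "N \<lhd> SA" and c: "c \<noteq> 0" "expa (pdiff k) (Cst c) \<in> N" and ij: "i \<noteq> j"
  shows "expa (pdiff i) (Cst a * X j) \<in> N"
proof -
  \<comment> \<open>Translations along \<open>k\<close> by other amounts are reached by going
    through a second direction \<open>k'\<close> and back.\<close>
  obtain k' where k': "k' \<noteq> k" using ij by metis
  have tr: "expa (pdiff l) (Cst b) \<in> N" for l b
    using translations_in_normal[OF N c, of l b] translations_in_normal[OF N _ translations_in_normal[OF N c k'], of 1 l b] k'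
    by (cases "l = k") auto
  let ?F = "Cst (a / 2) * X j ^ 2 :: ('n, 'k) mpol"
  have F: "pdiff i ?F = 0"
    using ij by (simp add: pdiff_mult pdiff_X power2_eq_square)
  have "expa (pdiff i) (poly (taylor (pdiff j) ?F) (Cst 1) - ?F) \<in> N"
    using tr[of j 1] F by (intro commutator_expa_expa lnd_pdiff pdiff_commute N) auto
  moreover have "poly (taylor (pdiff j) ?F) (Cst 1) - ?F = Cst a * X j + Cst (a / 2)"
  proof -
    have "poly (taylor (pdiff j) ?F) (Cst 1) = psubst (expa (pdiff j) (Cst 1)) ?F"
      by (rule psubst_expa[symmetric]) (simp_all add: lnd_pdiff)
    also have "\<dots> = Cst (a / 2) * (X j + 1) ^ 2"
      by (simp only: psubst_mult psubst_Cst power2_eq_square psubst_X expa_pdiff_apply[OF pdiff_1] refl if_True Cst_1)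
    also have "\<dots> = ?F + (Cst (a / 2) + Cst (a / 2)) * X j + Cst (a / 2)"
      by (simp add: power2_eq_square algebra_simps)
    also have "Cst (a / 2) + Cst (a / 2) = (Cst a :: ('n, 'k) mpol)"
      by (simp flip: Cst_add)
    finally show ?thesis by simp
  qed
  \<comment> \<open>Shifting \<open>X j\<close> by \<open>1\<close> changes \<open>?F\<close> by
    \<open>a X j + a / 2\<close>; a translation removes the constant \<open>a / 2\<close>.\<close>
  ultimately have "pcomp (expa (pdiff i) (Cst a * X j + Cst (a / 2))) (expa (pdiff i) (Cst (- a / 2))) \<in> N"
    using normal_SA_pcomp[OF N] tr by auto
  then show ?thesis
    using ij by (subst (asm) pcomp_expa[OF lnd_pdiff])
      (simp_all add: pdiff_add pdiff_mult pdiff_X Cst_minus derivation_minus[OF derivation_pdiff])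
qed

lemma SL_subset_normal:
  fixes N :: "('n::{finite,linorder}, 'k::field_char_0) pendo set"
  assumes N: "N \<lhd> SA" and c: "c \<noteq> 0" "expa (pdiff k) (Cst c) \<in> N"
  shows "SL \<subseteq> N"
proof -
  have "linear_endo A \<in> N" if "det A = 1" for A :: "(('k, 'n) vec, 'n) vec"
    using that
  proof (induction A rule: SL_row_induct)
    case one
    then show ?case
      using subgroup.one_closed[OF normal_imp_subgroup[OF N]] by (simp add: linear_endo_mat_1)
  next
    case (row_add A i j a)
    then show ?case
      using transvections_in_normal[OF N c, of i j a] normal_SA_pcomp[OF N]
      by (simp add: linear_endo_row_add)
  qed
  then show ?thesis by (auto simp: SL_def)
qed

text \<open>Differences are taken in one direction after another. Partial derivatives commute, so
  directions already killed stay killed; \<open>n\<close> belongs to the set from the start to keep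
  \<open>H\<close> in the kernel of \<open>pdiff n\<close>.\<close>

lemma elementary_descent:
  fixes N :: "('n::{finite,linorder}, 'k::field_char_0) pendo set"
  assumes N: "N \<lhd> SA" and H: "H \<noteq> 0" "pdiff n H = 0" "expa (pdiff n) H \<in> N"
  obtains c where "c \<noteq> 0" "expa (pdiff n) (Cst c) \<in> N"
proof -
  have "\<exists>H. H \<noteq> 0 \<and> (\<forall>j\<in>insert n S. pdiff j H = 0) \<and> expa (pdiff n) H \<in> N" for S
    using finite[of S]
  proof (induction S rule: finite_induct)
    case empty
    with H show ?case by auto
  next
    case (insert k S)
    let ?P = "\<lambda>H. (\<forall>j\<in>insert n S. pdiff j H = 0) \<and> expa (pdiff n) H \<in> N"
    from insert obtain H where H: "H \<noteq> 0" "?P H" by blast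
    have "?P (poly (taylor (pdiff k) H) 1 - H)" if "?P H" for H
    proof
      show "\<forall>j\<in>insert n S. pdiff j (poly (taylor (pdiff k) H) 1 - H) = 0"
      proof
        fix j assume "j \<in> insert n S"
        with that have j: "pdiff j H = 0" by blast
        have "pdiff j (poly (taylor (pdiff k) H) 1) = poly (taylor (pdiff k) (pdiff j H)) 1"
          by (rule derivation_poly_taylor) (simp_all add: lnd_pdiff derivation_pdiff pdiff_commute)
        then show "pdiff j (poly (taylor (pdiff k) H) 1 - H) = 0"
          by (simp add: j derivation_diff[OF derivation_pdiff] taylor_0[OF lnd_pdiff])
      qed
      show "expa (pdiff n) (poly (taylor (pdiff k) H) 1 - H) \<in> N"
        using that by (intro commutator_expa_expa N lnd_pdiff pdiff_commute) auto
    qed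
    from difference_descent[of "pdiff k" ?P, OF lnd_pdiff H(2) H(1) this]
    show ?case by auto
  qed
  from this[of UNIV] obtain H where H: "H \<noteq> 0" "\<And>j. pdiff j H = 0" "expa (pdiff n) H \<in> N"
    by auto
  from pdiff_all_0_imp_Cst[OF H(2)] obtain c where "H = Cst c" by blast
  with H that[of c] show thesis by (cases "c = 0") auto
qed

lemma exp_triangular_elementary:
  fixes D :: "('n::{finite,linorder}, 'k::field_char_0) mpol \<Rightarrow> ('n, 'k) mpol"
  assumes tri: "triangular_derivation D" and D0: "D \<noteq> (\<lambda>P. 0)" and F: "D F = 0" "F \<noteq> 0"
    and N: "N \<lhd> SA" and mem: "expa D F \<in> N"
  obtains n H where "H \<noteq> 0" "pdiff n H = 0" "expa (pdiff n) H \<in> N"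
proof -
  define n where "n = Max (UNIV :: 'n set)"
  have n: "i \<le> n" for i by (simp add: n_def)
  have D: "lnd D" by (rule lnd_triangular[OF tri])
  note der = lnd_derivation[OF D]
  have DX: "D (X i) \<in> polys_in {..<i}" for i
    using tri by (simp add: triangular_derivation_def)
  \<comment> \<open>By triangularity the largest variable occurs in no \<open>D (X i)\<close>, which
    is why \<open>D\<close> commutes with \<open>pdiff n\<close>.\<close>
  have nX: "pdiff n (D (X i)) = 0" for i
    using n[of i] by (intro derivation_polys_in[OF derivation_pdiff _ DX]) (auto simp: pdiff_X)
  have comm: "pdiff n (D p) = D (pdiff n p)" for p
    by (rule derivations_commute[OF derivation_pdiff der])
      (simp add: nX pdiff_X derivation_0[OF der] derivation_1[OF der])
  obtain F' where F': "F' \<noteq> 0" "pdiff n F' = 0" "D F' = 0" "expa D F' \<in> N"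
  proof (rule difference_descent[of "pdiff n" "\<lambda>H. D H = 0 \<and> expa D H \<in> N" F])
    fix H assume H: "D H = 0 \<and> expa D H \<in> N"
    have "D (poly (taylor (pdiff n) H) 1) = poly (taylor (pdiff n) (D H)) 1"
      by (rule derivation_poly_taylor) (simp_all add: lnd_pdiff der comm derivation_1[OF der])
    moreover have "expa D (poly (taylor (pdiff n) H) 1 - H) \<in> N"
      using H by (intro commutator_expa_expa N D lnd_pdiff) (simp_all add: comm derivation_1[OF der])
    ultimately show "D (poly (taylor (pdiff n) H) 1 - H) = 0 \<and> expa D (poly (taylor (pdiff n) H) 1 - H) \<in> N"
      using H by (simp add: derivation_diff[OF der] taylor_0[OF lnd_pdiff])
  qed (use F mem lnd_pdiff in auto)
  have "\<exists>i. D (X i) \<noteq> 0"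
  proof (rule ccontr)
    assume "\<not> (\<exists>i. D (X i) \<noteq> 0)"
    then have "D p = 0" for p
      using derivation_polys_in[OF der, of UNIV p] by (simp add: polys_in_def)
    with D0 show False by blast
  qed
  then have ne: "{i. D (X i) \<noteq> 0} \<noteq> {}" by blast
  define m where "m = Min {i. D (X i) \<noteq> 0}"
  have m: "D (X m) \<noteq> 0"
    using Min_in[OF finite ne] unfolding m_def by blast
  have lt: "D (X i) = 0" if "i < m" for i
    using Min_le[of "{i. D (X i) \<noteq> 0}" i] that unfolding m_def[symmetric] by force
  show thesis
  proof (rule that)
    show "D (X m) * F' \<noteq> 0" using m F' by simp
    show "pdiff n (D (X m) * F') = 0" by (simp add: pdiff_mult nX F')
    show "expa (pdiff n) (D (X m) * F') \<in> N"
    proof (cases "m = n")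
      case True
      \<comment> \<open>All variables but the last are killed, so \<open>D\<close> is a multiple of
        \<open>pdiff n\<close> and \<open>F' D\<close> is already of the required form.\<close>
      have "D p = D (X m) * pdiff n p" for p
      proof (rule derivation_ext[OF der derivation_mult_left[OF derivation_pdiff]])
        fix i
        show "D (X i) = D (X m) * pdiff n (X i)"
          using lt[of i] n[of i] True by (cases "i = n") (auto simp: pdiff_X)
      qed
      then have "(\<lambda>p. F' * D p) = (\<lambda>p. D (X m) * F' * pdiff n p)"
        by (metis mult.assoc mult.commute)
      with F'(4) show ?thesis by (simp only: expa_def)
    next
      case False
      \<comment> \<open>\<open>D (X m)\<close> involves only variables below \<open>m\<close>, which
        \<open>D\<close> kills by minimality; hence \<open>exp(F' D)\<close> moves
        \<open>X m\<close> by exactly \<open>D (X m) * F'\<close>.\<close>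
      have "D (D (X m)) = 0"
        using derivation_polys_in[OF der _ DX] lt by blast
      then have "poly (taylor D (X m)) F' - X m = D (X m) * F'"
        by (simp add: poly_taylor_square_zero[OF D])
      \<comment> \<open>Here the conjugating factor \<open>exp(F' D)\<close> is the one known to lie
        in \<open>N\<close>; since \<open>m\<close> is not \<open>n\<close>,
        \<open>exp(X m \<partial>\<^sub>n)\<close> is defined as required.\<close>
      moreover have "expa (pdiff n) (poly (taylor D (X m)) F' - X m) \<in> N"
        using F' False by (intro commutator_expa_expa N D lnd_pdiff comm) (auto simp: pdiff_X)
      ultimately show ?thesis by simp
    qed
  qed
qed

theorem theorem24:
  fixes D :: "('n::{finite,linorder}, 'k::field_char_0) mpol \<Rightarrow> ('n, 'k) mpol"
    and F :: "('n, 'k) mpol"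
  assumes "triangular_derivation D"
    and "D \<noteq> (\<lambda>P. 0)"
    and "D F = 0"
    and "F \<noteq> 0"
  shows "normally_cotame (exp_aut (\<lambda>P. F * D P))"
proof -
  \<comment> \<open>\<open>SLIN\<close> is the intersection of the normal subgroups containing
    \<open>SL\<close>, so it suffices that each \<open>N\<close> containing the exponential contains
    \<open>SL\<close>.\<close>
  have "SL \<subseteq> N" if N: "N \<lhd> SA" and mem: "expa D F \<in> N" for N
    using exp_triangular_elementary[OF assms N mem] elementary_descent[OF N] SL_subset_normal[OF N]
    by metis
  then show ?thesis
    unfolding normally_cotame_def expa_def[symmetric] SLIN_def normal_closure_def
    using expa_in_SA[OF lnd_triangular[OF assms(1)] assms(3)] by blast
qed

end
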